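(* Let $1<p<\infty$, $R>0$ and $I=(-R,R)$, and let $X_I$ and $Q_I$ be the logarithmic $p$-flux and the associated function of the first Dirichlet $p$-eigenfunction on $I$ (as defined in the context). Then, for every distinct $x,y\in I$, \[ \left(X_I(y)-X_I(x)\right)\frac{y-x}{|y-x|}\le -2Q_I\!\left(\frac{|x-y|}{2}\right). \] Moreover, equality holds if and only if $x=-y$.
   Context: For a bounded domain $\Omega\subset\mathbb R^N$ and $1<p<\infty$, the first Dirichlet eigenvalue of the $p$-Laplacian is \[ \lambda_{1,p}(\Omega)=\inf_{u\in W_0^{1,p}(\Omega)\setminus\{0\}}\frac{\int_\Omega|\nabla u|^p\,dx}{\int_\Omega|u|^p\,dx}, \] and a first eigenfunction is a positive minimizer $u>0$ (unique up to a positive multiplicative constant); it solves $-\operatorname{div}(|\nabla u|^{p-2}\nabla u)=\lambda_{1,p}(\Omega)u^{p-1}$ weakly in $\Omega$, $u=0$ on $\partial\Omega$. One-dimensional model: $I=(-R,R)$, $u_I>0$ is the first eigenfunction on $I$ normalized by $u_I(0)=1$. It is even, $u_I(\pm R)=0$, $u_I'(0)=0$, $u_I'(x)<0$ for $0<x<R$. Write $u_I(x)=U_I(r)$ with $r=|x|$ and define \[ q_I(r):=-\frac{U_I'(r)}{U_I(r)},\qquad Q_I(r):=q_I(r)^{p-1},\qquad 0\le r<R, \] so $q_I(0)=Q_I(0)=0$. The logarithmic $p$-flux is \[ X_I(x):=|(\log u_I)'(x)|^{p-2}(\log u_I)'(x)=-\operatorname{sgn}(x)\,Q_I(|x|),\qquad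 x\in I, \] with $\operatorname{sgn}(0)=0$ (so $X_I(0)=0$). *)

theory Defs
  imports "HOL-Analysis.Analysis"
begin

definition test_function :: "real set \<Rightarrow> (real \<Rightarrow> real) \<Rightarrow> bool" where
  "test_function \<Omega> \<phi> \<longleftrightarrow>
     (\<forall>k x. ((deriv ^^ k) \<phi>) differentiable (at x)) \<and>
     compact (closure {x. \<phi> x \<noteq> 0}) \<and> closure {x. \<phi> x \<noteq> 0} \<subseteq> \<Omega>"

definition Lp_on :: "real \<Rightarrow> real set \<Rightarrow> (real \<Rightarrow> real) \<Rightarrow> bool" where
  "Lp_on p \<Omega> f \<longleftrightarrow>
     f \<in> borel_measurable (lebesgue_on \<Omega>) \<and>
     integrable (lebesgue_on \<Omega>) (\<lambda>x. \<bar>f x\<bar> powr p)"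

text \<open>
  The predicates below relate a function \<open>u\<close> to a weak derivative \<open>v\<close> of it
  on the open set \<open>\<Omega>\<close>; \<open>v\<close> is determined by \<open>u\<close> up to a null set, so
  every integral of \<open>\<bar>v\<bar> powr p\<close> depends on \<open>u\<close> only.
  \<open>sobolev p \<Omega> u v\<close> means that \<open>u\<close> belongs to \<open>W\<^sup>1\<^sup>,\<^sup>p(\<Omega>)\<close> with weak derivative \<open>v\<close>.
  \<open>sobolev0 p \<Omega> u v\<close> says in addition that \<open>u\<close> lies in \<open>W\<^sub>0\<^sup>1\<^sup>,\<^sup>p(\<Omega>)\<close>, the closure
  of the test functions in the \<open>W\<^sup>1\<^sup>,\<^sup>p\<close> norm.
\<close>

definition sobolev :: "real \<Rightarrow> real set \<Rightarrow> (real \<Rightarrow> real) \<Rightarrow> (real \<Rightarrow> real) \<Rightarrow> bool" where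
  "sobolev p \<Omega> u v \<longleftrightarrow>
     Lp_on p \<Omega> u \<and> Lp_on p \<Omega> v \<and>
     (\<forall>\<phi>. test_function \<Omega> \<phi> \<longrightarrow>
        (\<integral>x. u x * deriv \<phi> x \<partial>lebesgue_on \<Omega>) = - (\<integral>x. v x * \<phi> x \<partial>lebesgue_on \<Omega>))"

definition sobolev0 :: "real \<Rightarrow> real set \<Rightarrow> (real \<Rightarrow> real) \<Rightarrow> (real \<Rightarrow> real) \<Rightarrow> bool" where
  "sobolev0 p \<Omega> u v \<longleftrightarrow>
     sobolev p \<Omega> u v \<and>
     (\<exists>\<phi>. (\<forall>n::nat. test_function \<Omega> (\<phi> n)) \<and>
        (\<lambda>n. (\<integral>x. \<bar>\<phi> n x - u x\<bar> powr p \<partial>lebesgue_on \<Omega>)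
            + (\<integral>x. \<bar>deriv (\<phi> n) x - v x\<bar> powr p \<partial>lebesgue_on \<Omega>)) \<longlonglongrightarrow> 0)"

definition rayleigh :: "real \<Rightarrow> real set \<Rightarrow> (real \<Rightarrow> real) \<Rightarrow> (real \<Rightarrow> real) \<Rightarrow> real" where
  "rayleigh p \<Omega> u v =
     (\<integral>x. \<bar>v x\<bar> powr p \<partial>lebesgue_on \<Omega>) / (\<integral>x. \<bar>u x\<bar> powr p \<partial>lebesgue_on \<Omega>)"

definition first_eigenvalue :: "real \<Rightarrow> real set \<Rightarrow> real" where
  "first_eigenvalue p \<Omega> =
     Inf {rayleigh p \<Omega> u v | u v. sobolev0 p \<Omega> u v \<and> \<not> (AE x in lebesgue_on \<Omega>. u x = 0)}"

text \<open>
  Elements of the Sobolev space are functions modulo null sets; a first eigenfunction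
  is taken to be the continuous representative, so that its point values and its
  classical derivative make sense. No differentiability, symmetry or boundary
  behaviour is built in. Values outside \<open>\<Omega>\<close> are irrelevant.
\<close>

definition first_eigenfunction :: "real \<Rightarrow> real set \<Rightarrow> (real \<Rightarrow> real) \<Rightarrow> bool" where
  "first_eigenfunction p \<Omega> u \<longleftrightarrow>
     continuous_on \<Omega> u \<and> (\<forall>x\<in>\<Omega>. 0 < u x) \<and>
     (\<exists>v. sobolev0 p \<Omega> u v \<and> rayleigh p \<Omega> u v = first_eigenvalue p \<Omega>)"

text \<open>
  For \<open>r \<ge> 0\<close> the radial profile of an even function \<open>u\<close> is \<open>U r = u r\<close>.
\<close>

definition log_q :: "(real \<Rightarrow> real) \<Rightarrow> real \<Rightarrow> real" where
  "log_q u r = - (deriv u r / u r)"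

definition log_Q :: "real \<Rightarrow> (real \<Rightarrow> real) \<Rightarrow> real \<Rightarrow> real" where
  "log_Q p u r = log_q u r powr (p - 1)"

text \<open>
  Where the logarithmic derivative vanishes, the product below is \<open>0\<close> for every
  \<open>p\<close>, because \<open>0 powr a = 0\<close>.
\<close>

definition log_flux :: "real \<Rightarrow> (real \<Rightarrow> real) \<Rightarrow> real \<Rightarrow> real" where
  "log_flux p u x =
     \<bar>deriv (\<lambda>t. ln (u t)) x\<bar> powr (p - 2) * deriv (\<lambda>t. ln (u t)) x"

end

theory Submission
  imports Defs
begin

text \<open>
  A minimizer \<open>u\<close> satisfies the weak equation \<open>(\<bar>u'\<bar>\<^sup>p\<^sup>-\<^sup>2 u')' = - \<lambda> u\<^sup>p\<^sup>-\<^sup>1\<close>; by the lemma of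
  du Bois-Reymond it holds classically, and approximation by test functions gives \<open>u \<rightarrow> 0\<close> at
  the end points. Hence the flux \<open>X\<close> solves the autonomous Riccati equation \<open>X' = - F X\<close>, where
  \<open>F s = \<lambda> + (p - 1) \<bar>s\<bar> powr (p / (p - 1))\<close> is even, positive and strictly increasing in \<open>\<bar>s\<bar>\<close>,
  and \<open>X\<close> is unbounded at both ends. These properties force \<open>X\<close> to be odd. With \<open>T = - X\<close>,
  \<open>d = (y - x) / 2\<close> and \<open>m = (x + y) / 2\<close> one has \<open>T y - T x = T (d + m) + T (d - m)\<close>, an
  even function of \<open>m\<close> with derivative \<open>F (T (d + m)) - F (T (d - m)) > 0\<close> for \<open>m > 0\<close>, so it is
  minimal exactly at \<open>m = 0\<close>.
\<close>

section \<open>Smooth functions\<close>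

text \<open>The minimizer is given only as a continuous function with an L^p weak derivative
  \<open>v\<close>. What gains regularity is not \<open>v\<close> but its flux
  \<open>signed_powr (p - 1) (v x)\<close>: recovering u' from the flux takes the power 1 / (p - 1),
  which for p > 2 is not differentiable at 0, so u' itself need not be differentiable where it
  vanishes. The equation is therefore kept as the first-order system u' = \<open>V\<close>,
  \<open>W\<close>' = - lam u^(p-1), with \<open>W\<close> the flux of \<open>V\<close>, and the
  Riccati equation is obtained by differentiating \<open>W\<close> and \<open>u\<close> only; u''
  never occurs.

  Test functions are infinitely differentiable with compact support, so smooth bumps have to be
  constructed explicitly; they supply the variations for the lemma of du Bois-Reymond. The
  unboundedness of \<open>X\<close> comes from a Gronwall estimate: a one-sided bound on the flux
  bounds u'/u, so \<open>u\<close> could decay at most exponentially and could not reach 0 at an end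
  point.\<close>

primrec differentiable_upto :: "nat \<Rightarrow> (real \<Rightarrow> real) \<Rightarrow> bool" where
  "differentiable_upto 0 f \<longleftrightarrow> (\<forall>x. f differentiable at x)"
| "differentiable_upto (Suc n) f \<longleftrightarrow> (\<forall>x. f differentiable at x) \<and> differentiable_upto n (deriv f)"

definition smooth :: "(real \<Rightarrow> real) \<Rightarrow> bool" where
  "smooth f \<longleftrightarrow> (\<forall>k x. ((deriv ^^ k) f) differentiable (at x))"

lemma DERIV_deriv_of_differentiable:
  fixes f :: "real \<Rightarrow> real"
  assumes "f differentiable at x"
  shows "(f has_real_derivative deriv f x) (at x)"
  using assms DERIV_deriv_iff_real_differentiable by blast

lemma differentiable_upto_iff:
  "differentiable_upto n f \<longleftrightarrow> (\<forall>k\<le>n. \<forall>x. ((deriv ^^ k) f) differentiable (at x))"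
proof (induction n arbitrary: f)
  case 0
  then show ?case by simp
next
  case (Suc n)
  have "(\<forall>k\<le>Suc n. P k) \<longleftrightarrow> P 0 \<and> (\<forall>k\<le>n. P (Suc k))" for P
    by (metis Suc_le_mono le0 nat.exhaust)
  then show ?case using Suc by (simp add: funpow_swap1)
qed

lemma smooth_iff_differentiable_upto: "smooth f \<longleftrightarrow> (\<forall>n. differentiable_upto n f)"
  unfolding smooth_def differentiable_upto_iff by auto

lemma differentiable_upto_SucD: "differentiable_upto (Suc n) f \<Longrightarrow> differentiable_upto n f"
  by (simp add: differentiable_upto_iff)

lemma differentiable_uptoD: "differentiable_upto n f \<Longrightarrow> f differentiable at x"
  by (cases n) auto

lemma differentiable_upto_add:
  "differentiable_upto n f \<Longrightarrow> differentiable_upto n g \<Longrightarrow> differentiable_upto n (\<lambda>x. f x + g x)"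
proof (induction n arbitrary: f g)
  case 0
  then show ?case by simp
next
  case (Suc n)
  have "deriv (\<lambda>x. f x + g x) = (\<lambda>x. deriv f x + deriv g x)"
    using Suc.prems by (intro ext DERIV_imp_deriv DERIV_add DERIV_deriv_of_differentiable) auto
  with Suc show ?case by simp
qed

text \<open>Counting orders makes an induction over all pairs \<open>f\<close>, \<open>g\<close>
  possible: each term of the product rule has one factor that loses an order and one with an order
  to spare.\<close>

lemma differentiable_upto_mult:
  "differentiable_upto n f \<Longrightarrow> differentiable_upto n g \<Longrightarrow> differentiable_upto n (\<lambda>x. f x * g x)"
proof (induction n arbitrary: f g)
  case 0
  then show ?case by simp
next
  case (Suc n)
  have "deriv (\<lambda>x. f x * g x) = (\<lambda>x. deriv f x * g x + deriv g x * f x)"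
    using Suc.prems by (intro ext DERIV_imp_deriv DERIV_mult DERIV_deriv_of_differentiable) auto
  moreover have "differentiable_upto n f" "differentiable_upto n g"
    using Suc.prems by (blast dest: differentiable_upto_SucD)+
  ultimately show ?case
    using Suc by (auto intro!: differentiable_upto_add)
qed

lemma smooth_add: "smooth f \<Longrightarrow> smooth g \<Longrightarrow> smooth (\<lambda>x. f x + g x)"
  by (simp add: smooth_iff_differentiable_upto differentiable_upto_add)

lemma smooth_mult: "smooth f \<Longrightarrow> smooth g \<Longrightarrow> smooth (\<lambda>x. f x * g x)"
  by (simp add: smooth_iff_differentiable_upto differentiable_upto_mult)

text \<open>All iterated derivatives stay in \<open>S\<close>, so a family closed under
  differentiation takes the place of a formula for the k-th derivative.\<close>

lemma smooth_coinduct: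
  assumes "f \<in> S"
    and step: "\<And>f. f \<in> S \<Longrightarrow> \<exists>g\<in>S. \<forall>x. (f has_real_derivative g x) (at x)"
  shows "smooth f"
proof -
  have "(deriv ^^ k) f \<in> S" for k
  proof (induction k)
    case (Suc k)
    obtain g where "g \<in> S" "\<forall>x. ((deriv ^^ k) f has_real_derivative g x) (at x)"
      using step[OF Suc] by blast
    moreover from this have "deriv ((deriv ^^ k) f) = g"
      by (intro ext DERIV_imp_deriv) auto
    ultimately show ?case by simp
  qed (simp add: assms)
  with step show ?thesis
    unfolding smooth_def real_differentiable_def by blast
qed

lemma smooth_const: "smooth (\<lambda>x. c)"
  by (rule smooth_coinduct[of _ "range (\<lambda>c x. c)"]) (auto intro!: exI[of _ 0])

lemma smooth_antiderivative:
  assumes "\<And>x. (f has_real_derivative g x) (at x)" "smooth g"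
  shows "smooth f"
  unfolding smooth_def
proof (intro allI)
  fix k x
  have "deriv f = g" using assms(1) by (intro ext DERIV_imp_deriv)
  then show "(deriv ^^ k) f differentiable at x"
    using assms by (cases k) (auto simp: funpow_swap1 smooth_def real_differentiable_def)
qed

lemma smooth_DERIV: "smooth f \<Longrightarrow> (f has_real_derivative deriv f x) (at x)"
  by (metis DERIV_deriv_of_differentiable differentiable_uptoD smooth_iff_differentiable_upto)

lemma smooth_deriv: "smooth f \<Longrightarrow> smooth (deriv f)"
  by (metis differentiable_upto.simps(2) smooth_iff_differentiable_upto)

text \<open>The polynomial factor makes this family closed under differentiation.\<close>

definition flat :: "real poly \<Rightarrow> real \<Rightarrow> real" where
  "flat P x = (if x > 0 then poly P (1 / x) * exp (- (1 / x)) else 0)"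

text \<open>The factor \<open>y ^ n\<close> is there for the induction on \<open>P\<close>: peeling
  off a coefficient leaves the claim for the shorter polynomial with exponent
  \<open>Suc n\<close>.\<close>

lemma power_mult_poly_div_exp_tendsto:
  "((\<lambda>y::real. y ^ n * poly P y / exp y) \<longlongrightarrow> 0) at_top"
proof (induction P arbitrary: n)
  case (pCons c P)
  have "((\<lambda>y::real. c * (y ^ n / exp y) + y ^ Suc n * poly P y / exp y) \<longlongrightarrow> c * 0 + 0) at_top"
    by (intro tendsto_intros pCons.IH tendsto_power_div_exp_0)
  then show ?case
    by (simp add: algebra_simps add_divide_distrib)
qed auto

text \<open>Substitute y = 1 / x; the division by x is one more factor y, absorbed into the
  polynomial as \<open>pCons 0 P\<close>. This is the difference quotient of \<open>flat P\<close>
  at 0 from the right.\<close>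

lemma flat_div_tendsto: "((\<lambda>x. flat P x / x) \<longlongrightarrow> 0) (at_right 0)"
proof -
  have "((\<lambda>y. poly (pCons 0 P) y / exp y) \<longlongrightarrow> 0) at_top"
    using power_mult_poly_div_exp_tendsto[of 0 "pCons 0 P"] by simp
  then have "((\<lambda>x. poly (pCons 0 P) (inverse x) / exp (inverse x)) \<longlongrightarrow> 0) (at_right (0::real))"
    using filterlim_compose filterlim_inverse_at_top_right by blast
  then show ?thesis
    by (rule Lim_transform_eventually)
      (auto simp: flat_def eventually_at_filter exp_minus divide_simps)
qed

text \<open>With y = 1 / x one has dy/dx = - y^2, so the derivative of P(y) exp(-y) is y^2 (P(y) -
  P'(y)) exp(-y), again of the same form.\<close>

lemma flat_DERIV:
  "(flat P has_real_derivative flat ([:0, 0, 1:] * (P - pderiv P)) x) (at x)"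
proof -
  consider "x > 0" | "x < 0" | "x = 0" by linarith
  then show ?thesis
  proof cases
    case 1
    have "((\<lambda>x. poly P (1 / x) * exp (- (1 / x))) has_real_derivative
        flat ([:0, 0, 1:] * (P - pderiv P)) x) (at x)"
      using 1 by (auto intro!: derivative_eq_intros DERIV_chain2[OF poly_DERIV] simp: flat_def field_simps power2_eq_square)
    then show ?thesis
      by (rule has_field_derivative_transform_within_open[of _ _ _ "{0<..}"])
        (use 1 in \<open>auto simp: flat_def\<close>)
  next
    case 2
    have "((\<lambda>x. 0) has_real_derivative flat ([:0, 0, 1:] * (P - pderiv P)) x) (at x)"
      using 2 by (auto simp: flat_def)
    then show ?thesis
      by (rule has_field_derivative_transform_within_open[of _ _ _ "{..<0}"])
        (use 2 in \<open>auto simp: flat_def\<close>)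
  next
    case 3
    have "((\<lambda>x. flat P x / x) \<longlongrightarrow> 0) (at_left 0)"
      by (rule tendsto_eventually) (auto simp: flat_def eventually_at_filter)
    with flat_div_tendsto have "((\<lambda>x. flat P x / x) \<longlongrightarrow> 0) (at 0)"
      by (simp add: filterlim_split_at)
    then show ?thesis
      using 3 by (simp add: DERIV_def flat_def)
  qed
qed

lemma smooth_flat: "smooth (\<lambda>x. flat P (a * x + b))"
proof (rule smooth_coinduct[of _ "range (\<lambda>P x. flat P (a * x + b))"])
  fix f assume "f \<in> range (\<lambda>P x. flat P (a * x + b))"
  then obtain P where P: "f = (\<lambda>x. flat P (a * x + b))" by auto
  \<comment> \<open>The chain rule produces a factor \<open>a\<close>; absorbing it into the
    polynomial keeps the family closed under differentiation.\<close>
  have "flat (smult a Q) y = flat Q y * a" for Q y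
    by (simp add: flat_def)
  moreover have "((\<lambda>x. flat P (a * x + b)) has_real_derivative
      flat ([:0, 0, 1:] * (P - pderiv P)) (a * x + b) * a) (at x)" for x
    by (rule DERIV_chain2[OF flat_DERIV]) (auto intro!: derivative_eq_intros)
  ultimately show "\<exists>g\<in>range (\<lambda>P x. flat P (a * x + b)). \<forall>x. (f has_real_derivative g x) (at x)"
    unfolding P by (intro bexI[OF _ rangeI[of _ "smult a ([:0, 0, 1:] * (P - pderiv P))"]]) metis
qed auto

text \<open>A product of two flat functions, one for each end. The parameter \<epsilon> scales only
  the exponent: values stay between 0 and 1 and tend to 1 inside the interval as \<epsilon> tends to
  0, so bumps approximate indicators without normalization.\<close>

definition bump :: "real \<Rightarrow> real \<Rightarrow> real \<Rightarrow> real \<Rightarrow> real" where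
  "bump \<epsilon> a b x = (if a < x \<and> x < b then exp (- \<epsilon> * (1 / (x - a) + 1 / (b - x))) else 0)"

lemma smooth_bump:
  assumes "\<epsilon> > 0"
  shows "smooth (bump \<epsilon> a b)"
proof -
  have "bump \<epsilon> a b x = flat 1 (1 / \<epsilon> * x + (- a / \<epsilon>)) * flat 1 (- 1 / \<epsilon> * x + b / \<epsilon>)" for x
  proof -
    have "1 / \<epsilon> * x + (- a / \<epsilon>) = (x - a) / \<epsilon>" "- 1 / \<epsilon> * x + b / \<epsilon> = (b - x) / \<epsilon>"
      by (auto simp: diff_divide_distrib)
    then show ?thesis
      using assms by (simp add: bump_def flat_def zero_less_divide_iff distrib_left flip: exp_add)
  qed
  then show ?thesis
    using smooth_mult[OF smooth_flat smooth_flat, of 1 "1/\<epsilon>" "-a/\<epsilon>" 1 "-1/\<epsilon>" "b/\<epsilon>"] by presburger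
qed

section \<open>Test functions\<close>

lemma test_functionI:
  assumes "smooth \<phi>" "\<And>x. x \<notin> {c..d} \<Longrightarrow> \<phi> x = 0" "{c..d} \<subseteq> \<Omega>"
  shows "test_function \<Omega> \<phi>"
proof -
  have sub: "closure {x. \<phi> x \<noteq> 0} \<subseteq> {c..d}"
    using assms(2) by (intro closure_minimal) (blast, simp)
  moreover from this have "compact (closure {x. \<phi> x \<noteq> 0})"
    by (meson bounded_closed_interval bounded_subset closed_closure compact_eq_bounded_closed)
  ultimately show ?thesis
    using assms by (auto simp: test_function_def smooth_def)
qed

lemma test_function_smooth: "test_function \<Omega> \<phi> \<Longrightarrow> smooth \<phi>"
  by (simp add: test_function_def smooth_def)

text \<open>Compactness of the support leaves room next to \<open>a\<close> and \<open>b\<close>.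
  Arguments can thus be carried out on \<open>{c..d}\<close>, away from the end points where the
  other functions are not controlled.\<close>

lemma test_function_support:
  assumes \<phi>: "test_function {a<..<b} \<phi>" and "a < b"
  obtains c d where "a < c" "c < d" "d < b"
    "\<And>x. x \<le> c \<or> d \<le> x \<Longrightarrow> \<phi> x = 0 \<and> deriv \<phi> x = 0"
proof -
  define K where "K = closure {x. \<phi> x \<noteq> 0}"
  have K: "compact K" "K \<subseteq> {a<..<b}" "closed K"
    using \<phi> by (auto simp: K_def test_function_def)
  have zero: "\<phi> x = 0 \<and> deriv \<phi> x = 0" if "x \<notin> K" for x
  proof -
    have 0: "\<phi> y = 0" if "y \<in> - K" for y
      using that closure_subset[of "{x. \<phi> x \<noteq> 0}"] by (auto simp: K_def)
    have "(\<phi> has_real_derivative 0) (at x)"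
      by (rule has_field_derivative_transform_within_open[of "\<lambda>x. 0" _ _ "- K"])
        (use 0 that K(3) in auto)
    then show ?thesis using 0 that by (auto dest: DERIV_imp_deriv)
  qed
  obtain c d where cd: "a < c" "c < d" "d < b" "\<And>x. x \<in> K \<Longrightarrow> c < x \<and> x < d"
  proof (cases "K = {}")
    case True
    obtain c where "a < c" "c < b" using \<open>a < b\<close> dense by blast
    moreover from this obtain d where "c < d" "d < b" using dense by blast
    ultimately show ?thesis using that[of c d] True by auto
  next
    case False
    obtain m where m: "m \<in> K" "\<And>x. x \<in> K \<Longrightarrow> m \<le> x"
      using compact_attains_inf[OF K(1) False] by auto
    obtain M where M: "M \<in> K" "\<And>x. x \<in> K \<Longrightarrow> x \<le> M"
      using compact_attains_sup[OF K(1) False] by auto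
    have "a < m" "m \<le> M" "M < b" using m M K by auto
    obtain c where "a < c" "c < m" using dense[OF \<open>a < m\<close>] by blast
    obtain d where "M < d" "d < b" using dense[OF \<open>M < b\<close>] by blast
    have "c < d" using \<open>c < m\<close> \<open>m \<le> M\<close> \<open>M < d\<close> by linarith
    moreover have "c < x \<and> x < d" if "x \<in> K" for x
      using m(2)[OF that] M(2)[OF that] \<open>c < m\<close> \<open>M < d\<close> by linarith
    ultimately show ?thesis using that[of c d] \<open>a < c\<close> \<open>d < b\<close> by blast
  qed
  show ?thesis
  proof (rule that[OF cd(1-3)])
    fix x assume "x \<le> c \<or> d \<le> x"
    then have "x \<notin> K" using cd(4)[of x] by auto
    then show "\<phi> x = 0 \<and> deriv \<phi> x = 0" by (rule zero)
  qed
qed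

lemma test_function_add:
  assumes "test_function {a<..<b} \<phi>" "test_function {a<..<b} \<psi>" "a < b"
  shows "test_function {a<..<b} (\<lambda>x. \<phi> x + \<psi> x)"
proof -
  obtain c d where cd: "a < c" "c < d" "d < b" "\<And>x. x \<le> c \<or> d \<le> x \<Longrightarrow> \<phi> x = 0 \<and> deriv \<phi> x = 0"
    using test_function_support[OF assms(1,3)] by metis
  obtain c' d' where cd': "a < c'" "c' < d'" "d' < b" "\<And>x. x \<le> c' \<or> d' \<le> x \<Longrightarrow> \<psi> x = 0 \<and> deriv \<psi> x = 0"
    using test_function_support[OF assms(2,3)] by metis
  show ?thesis
  proof (rule test_functionI[of _ "min c c'" "max d d'"])
    show "smooth (\<lambda>x. \<phi> x + \<psi> x)"
      using assms by (intro smooth_add) (auto simp: test_function_smooth)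
    show "\<phi> x + \<psi> x = 0" if "x \<notin> {min c c'..max d d'}" for x
    proof -
      have "x \<le> c \<or> d \<le> x" "x \<le> c' \<or> d' \<le> x" using that by auto
      then show ?thesis using cd(4)[of x] cd'(4)[of x] by auto
    qed
  qed (use cd cd' in auto)
qed

lemma test_function_cmult:
  assumes "test_function {a<..<b} \<phi>" "a < b"
  shows "test_function {a<..<b} (\<lambda>x. t * \<phi> x)"
proof -
  obtain c d where cd: "a < c" "c < d" "d < b" "\<And>x. x \<le> c \<or> d \<le> x \<Longrightarrow> \<phi> x = 0 \<and> deriv \<phi> x = 0"
    using test_function_support[OF assms] by metis
  show ?thesis
  proof (rule test_functionI[of _ c d])
    show "smooth (\<lambda>x. t * \<phi> x)"
      using assms by (intro smooth_mult smooth_const) (auto simp: test_function_smooth)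
    show "t * \<phi> x = 0" if "x \<notin> {c..d}" for x
      using that cd(4)[of x] by auto
  qed (use cd in auto)
qed

lemma test_function_DERIV: "test_function \<Omega> \<phi> \<Longrightarrow> (\<phi> has_real_derivative deriv \<phi> x) (at x)"
  by (simp add: smooth_DERIV test_function_smooth)

lemma smooth_continuous_on: "smooth f \<Longrightarrow> continuous_on S f"
  by (meson DERIV_isCont continuous_at_imp_continuous_on smooth_DERIV)

lemma test_function_bounded:
  assumes \<phi>: "test_function {a<..<b} \<phi>" and "a < b"
  obtains B where "0 \<le> B" "\<And>x. \<bar>\<phi> x\<bar> \<le> B" "\<And>x. \<bar>deriv \<phi> x\<bar> \<le> B"
proof -
  obtain c d where cd: "a < c" "c < d" "d < b" "\<And>x. x \<le> c \<or> d \<le> x \<Longrightarrow> \<phi> x = 0 \<and> deriv \<phi> x = 0"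
    using test_function_support[OF assms] by metis
  have "bounded (\<phi> ` {c..d})" "bounded (deriv \<phi> ` {c..d})"
    using \<phi> by (auto intro!: compact_imp_bounded compact_continuous_image smooth_continuous_on
      smooth_deriv simp: test_function_smooth)
  then obtain B1 B2 where B: "\<And>x. x \<in> {c..d} \<Longrightarrow> \<bar>\<phi> x\<bar> \<le> B1" "\<And>x. x \<in> {c..d} \<Longrightarrow> \<bar>deriv \<phi> x\<bar> \<le> B2"
    unfolding bounded_iff by (metis image_eqI real_norm_def)
  have "\<bar>\<phi> x\<bar> \<le> max 0 (max B1 B2) \<and> \<bar>deriv \<phi> x\<bar> \<le> max 0 (max B1 B2)" for x
  proof (cases "x \<in> {c..d}")
    case True
    then show ?thesis using B[OF True] by auto
  next
    case False
    then show ?thesis using cd(4)[of x] by auto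
  qed
  then show ?thesis using that[of "max 0 (max B1 B2)"] by auto
qed

text \<open>As \<open>f\<close> is differentiable only inside the open interval, the fundamental
  theorem is applied on \<open>{c..d}\<close>, where both boundary terms vanish; outside, the
  integrand is 0.\<close>

lemma test_function_by_parts:
  assumes \<phi>: "test_function {a<..<b} \<phi>" and "a < b"
    and f: "\<And>x. x \<in> {a<..<b} \<Longrightarrow> (f has_real_derivative g x) (at x)"
  shows "((\<lambda>x. f x * deriv \<phi> x + g x * \<phi> x) has_integral 0) {a<..<b}"
proof -
  obtain c d where cd: "a < c" "c < d" "d < b" "\<And>x. x \<le> c \<or> d \<le> x \<Longrightarrow> \<phi> x = 0 \<and> deriv \<phi> x = 0"
    using test_function_support[OF assms(1,2)] by metis
  have "((\<lambda>x. f x * deriv \<phi> x + g x * \<phi> x) has_integral (f d * \<phi> d - f c * \<phi> c)) {c..d}"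
  proof (rule fundamental_theorem_of_calculus)
    fix x assume "x \<in> {c..d}"
    then have "x \<in> {a<..<b}" using cd(1-3) by auto
    from DERIV_mult[OF f[OF this] test_function_DERIV[OF \<phi>]]
    have "((\<lambda>x. f x * \<phi> x) has_real_derivative f x * deriv \<phi> x + g x * \<phi> x) (at x)"
      by (simp add: add.commute mult.commute)
    then show "((\<lambda>x. f x * \<phi> x) has_vector_derivative f x * deriv \<phi> x + g x * \<phi> x) (at x within {c..d})"
      by (simp add: has_real_derivative_iff_has_vector_derivative[symmetric] has_field_derivative_at_within)
  qed (use cd in auto)
  moreover have "f d * \<phi> d - f c * \<phi> c = 0" using cd(4)[of c] cd(4)[of d] by simp
  ultimately have "((\<lambda>x. f x * deriv \<phi> x + g x * \<phi> x) has_integral 0) {c..d}" by simp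
  then show ?thesis
    by (rule has_integral_on_superset) (use cd in auto)
qed

section \<open>Integrability and L^p functions on bounded intervals\<close>

lemma finite_measure_lebesgue_on_Ioo: "finite_measure (lebesgue_on {a<..<b::real})"
  by (rule finite_measure_lebesgue_on) auto

lemma test_function_measurable:
  assumes "test_function \<Omega> \<phi>" "S \<in> sets lebesgue"
  shows "\<phi> \<in> borel_measurable (lebesgue_on S)" "deriv \<phi> \<in> borel_measurable (lebesgue_on S)"
  using assms by (auto intro!: continuous_imp_measurable_on_sets_lebesgue smooth_continuous_on
      smooth_deriv simp: test_function_smooth)

lemma integrable_mult_bounded:
  fixes f g :: "'a \<Rightarrow> real"
  assumes "integrable M f" "g \<in> borel_measurable M" "\<And>x. \<bar>g x\<bar> \<le> B"
  shows "integrable M (\<lambda>x. f x * g x)"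
proof (rule Bochner_Integration.integrable_bound)
  show "integrable M (\<lambda>x. B * f x)" using assms by simp
  have "\<bar>f x\<bar> * \<bar>g x\<bar> \<le> \<bar>B\<bar> * \<bar>f x\<bar>" for x
    using assms(3)[of x] by (subst mult.commute) (intro mult_right_mono; linarith)
  then show "AE x in M. norm (f x * g x) \<le> norm (B * f x)"
    by (simp add: abs_mult)
  show "(\<lambda>x. f x * g x) \<in> borel_measurable M"
    using assms by measurable
qed

lemma integrable_mult_test_function:
  assumes \<phi>: "test_function {a<..<b} \<phi>" and "a < b" and "integrable (lebesgue_on {a<..<b}) f"
  shows "integrable (lebesgue_on {a<..<b}) (\<lambda>x. f x * \<phi> x)"
    "integrable (lebesgue_on {a<..<b}) (\<lambda>x. f x * deriv \<phi> x)"
proof -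
  obtain B where "\<And>x. \<bar>\<phi> x\<bar> \<le> B" "\<And>x. \<bar>deriv \<phi> x\<bar> \<le> B"
    using test_function_bounded[OF assms(1,2)] by metis
  then show "integrable (lebesgue_on {a<..<b}) (\<lambda>x. f x * \<phi> x)"
    "integrable (lebesgue_on {a<..<b}) (\<lambda>x. f x * deriv \<phi> x)"
    using test_function_measurable[OF \<phi>] assms by (auto intro!: integrable_mult_bounded)
qed

text \<open>A crude form of Minkowski's inequality, from
  \<open>\<bar>a + b\<bar> \<le> 2 * max \<bar>a\<bar> \<bar>b\<bar>\<close>. The constant is
  immaterial, since the bound only serves to produce integrable majorants.\<close>

lemma abs_add_powr_le:
  fixes a b p :: real
  assumes "0 \<le> p"
  shows "\<bar>a + b\<bar> powr p \<le> 2 powr p * (\<bar>a\<bar> powr p + \<bar>b\<bar> powr p)"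
proof -
  have "\<bar>a + b\<bar> powr p \<le> (2 * max \<bar>a\<bar> \<bar>b\<bar>) powr p"
    using assms by (intro powr_mono2) auto
  also have "\<dots> = 2 powr p * max \<bar>a\<bar> \<bar>b\<bar> powr p" by (simp add: powr_mult)
  also have "\<dots> \<le> 2 powr p * (\<bar>a\<bar> powr p + \<bar>b\<bar> powr p)"
    by (intro mult_left_mono) (auto simp: max_def)
  finally show ?thesis .
qed

lemma Lp_on_add:
  assumes "Lp_on p \<Omega> f" "Lp_on p \<Omega> g" "0 \<le> p"
  shows "Lp_on p \<Omega> (\<lambda>x. f x + g x)"
  unfolding Lp_on_def
proof
  show m: "(\<lambda>x. f x + g x) \<in> borel_measurable (lebesgue_on \<Omega>)"
    using assms by (auto simp: Lp_on_def)
  show "integrable (lebesgue_on \<Omega>) (\<lambda>x. \<bar>f x + g x\<bar> powr p)"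
  proof (rule Bochner_Integration.integrable_bound)
    show "integrable (lebesgue_on \<Omega>) (\<lambda>x. 2 powr p * (\<bar>f x\<bar> powr p + \<bar>g x\<bar> powr p))"
      using assms by (auto simp: Lp_on_def)
    have "norm (\<bar>f x + g x\<bar> powr p) \<le> norm (2 powr p * (\<bar>f x\<bar> powr p + \<bar>g x\<bar> powr p))" for x
      using abs_add_powr_le[OF assms(3), of "f x" "g x"] by (simp add: abs_mult)
    then show "AE x in lebesgue_on \<Omega>. norm (\<bar>f x + g x\<bar> powr p) \<le> norm (2 powr p * (\<bar>f x\<bar> powr p + \<bar>g x\<bar> powr p))"
      by simp
  qed (use m in measurable)
qed

lemma Lp_on_cmult: "Lp_on p \<Omega> f \<Longrightarrow> Lp_on p \<Omega> (\<lambda>x. c * f x)"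
  by (auto simp: Lp_on_def abs_mult powr_mult)

lemma Lp_on_bounded:
  assumes "f \<in> borel_measurable (lebesgue_on \<Omega>)" "\<And>x. \<bar>f x\<bar> \<le> B" "0 \<le> p" "\<Omega> \<in> lmeasurable"
  shows "Lp_on p \<Omega> f"
proof -
  interpret finite_measure "lebesgue_on \<Omega>" by (rule finite_measure_lebesgue_on[OF assms(4)])
  have "integrable (lebesgue_on \<Omega>) (\<lambda>x. \<bar>f x\<bar> powr p)"
    by (rule integrable_const_bound[of _ "B powr p"]) (use assms in \<open>auto intro!: powr_mono2 AE_I2\<close>)
  with assms show ?thesis by (simp add: Lp_on_def)
qed

lemma powr_le_one_add_powr:
  fixes a :: real
  assumes "0 \<le> a" "0 \<le> r" "r \<le> p"
  shows "a powr r \<le> 1 + a powr p"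
proof (cases "a \<le> 1")
  case True
  then have "a powr r \<le> 1 powr r" using assms by (intro powr_mono2) auto
  then show ?thesis by (simp add: add_increasing2)
next
  case False
  then have "a powr r \<le> a powr p" using assms by (intro powr_mono) auto
  then show ?thesis by simp
qed

text \<open>Applied with \<open>r = 1\<close>, to integrate \<open>u\<close> and \<open>v\<close>,
  and with \<open>r = p - 1\<close>, to integrate the flux. The latter exponent may be below 1, so
  only \<open>0 \<le> r\<close> is assumed.\<close>

lemma Lp_on_mono:
  assumes "Lp_on p \<Omega> f" "0 \<le> r" "r \<le> p" "\<Omega> \<in> lmeasurable"
  shows "Lp_on r \<Omega> f"
proof -
  interpret finite_measure "lebesgue_on \<Omega>" by (rule finite_measure_lebesgue_on[OF assms(4)])
  have "integrable (lebesgue_on \<Omega>) (\<lambda>x. \<bar>f x\<bar> powr r)"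
  proof (rule Bochner_Integration.integrable_bound)
    show "integrable (lebesgue_on \<Omega>) (\<lambda>x. 1 + \<bar>f x\<bar> powr p)"
      using assms by (auto simp: Lp_on_def)
    have "norm (\<bar>f x\<bar> powr r) \<le> norm (1 + \<bar>f x\<bar> powr p)" for x
      using powr_le_one_add_powr[OF abs_ge_zero assms(2,3), of "f x"] by simp
    then show "AE x in lebesgue_on \<Omega>. norm (\<bar>f x\<bar> powr r) \<le> norm (1 + \<bar>f x\<bar> powr p)"
      by simp
    show "(\<lambda>x. \<bar>f x\<bar> powr r) \<in> borel_measurable (lebesgue_on \<Omega>)"
      using assms(1) by (auto simp: Lp_on_def)
  qed
  with assms show ?thesis by (simp add: Lp_on_def)
qed

lemma Lp_on_imp_integrable:
  assumes "Lp_on p \<Omega> f" "1 \<le> p" "\<Omega> \<in> lmeasurable"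
  shows "integrable (lebesgue_on \<Omega>) f"
proof -
  have "Lp_on 1 \<Omega> f" by (rule Lp_on_mono[OF assms(1)]) (use assms in auto)
  then have "f \<in> borel_measurable (lebesgue_on \<Omega>)" "integrable (lebesgue_on \<Omega>) (\<lambda>x. \<bar>f x\<bar>)"
    by (auto simp: Lp_on_def)
  then show ?thesis by (simp add: integrable_abs_iff)
qed

lemma test_function_Lp:
  assumes "test_function {a<..<b} \<phi>" "a < b" "0 \<le> p"
  shows "Lp_on p {a<..<b} \<phi>" "Lp_on p {a<..<b} (deriv \<phi>)"
proof -
  obtain B where "\<And>x. \<bar>\<phi> x\<bar> \<le> B" "\<And>x. \<bar>deriv \<phi> x\<bar> \<le> B"
    using test_function_bounded[OF assms(1,2)] by metis
  then show "Lp_on p {a<..<b} \<phi>" "Lp_on p {a<..<b} (deriv \<phi>)"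
    using test_function_measurable[OF assms(1)] Lp_on_bounded[of _ "{a<..<b}" B p] assms(3) by simp_all
qed

section \<open>The Euler-Lagrange equation\<close>

lemma lebesgue_by_parts:
  assumes \<phi>: "test_function {a<..<b} \<phi>" and "a < b"
    and f: "\<And>x. x \<in> {a<..<b} \<Longrightarrow> (f has_real_derivative g x) (at x)"
    and int: "integrable (lebesgue_on {a<..<b}) f" "integrable (lebesgue_on {a<..<b}) g"
  shows "(\<integral>x. f x * deriv \<phi> x \<partial>lebesgue_on {a<..<b}) = - (\<integral>x. g x * \<phi> x \<partial>lebesgue_on {a<..<b})"
proof -
  note i = integrable_mult_test_function[OF assms(1,2)]
  have i2: "integrable (lebesgue_on {a<..<b}) (\<lambda>x. f x * deriv \<phi> x + g x * \<phi> x)"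
    using i int by auto
  have "(\<integral>x. f x * deriv \<phi> x + g x * \<phi> x \<partial>lebesgue_on {a<..<b}) = 0"
    using lebesgue_integral_eq_integral[OF i2] test_function_by_parts[OF assms(1-3)]
    by (simp add: integral_unique)
  then show ?thesis using i int by simp
qed

text \<open>This makes the variations of a minimizer admissible. Adding \<open>\<phi>\<close> to
  every member of the approximating sequence leaves the differences to the limit unchanged.\<close>

lemma sobolev0_add_test_function:
  assumes u: "sobolev0 p {a<..<b} u v" and "1 \<le> p" "a < b" and \<phi>: "test_function {a<..<b} \<phi>"
  shows "sobolev0 p {a<..<b} (\<lambda>x. u x + \<phi> x) (\<lambda>x. v x + deriv \<phi> x)"
proof -
  let ?I = "{a<..<b}"
  have Lp: "Lp_on p ?I u" "Lp_on p ?I v" "Lp_on p ?I \<phi>" "Lp_on p ?I (deriv \<phi>)"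
    using u test_function_Lp[OF \<phi> \<open>a < b\<close>, of p] \<open>1 \<le> p\<close> by (auto simp: sobolev0_def sobolev_def)
  then have int: "integrable (lebesgue_on ?I) u" "integrable (lebesgue_on ?I) v"
      "integrable (lebesgue_on ?I) \<phi>" "integrable (lebesgue_on ?I) (deriv \<phi>)"
    using \<open>1 \<le> p\<close> by (auto intro: Lp_on_imp_integrable)
  have weak: "(\<integral>x. (u x + \<phi> x) * deriv \<eta> x \<partial>lebesgue_on ?I)
      = - (\<integral>x. (v x + deriv \<phi> x) * \<eta> x \<partial>lebesgue_on ?I)" if \<eta>: "test_function ?I \<eta>" for \<eta>
  proof -
    have "(\<integral>x. \<phi> x * deriv \<eta> x \<partial>lebesgue_on ?I) = - (\<integral>x. deriv \<phi> x * \<eta> x \<partial>lebesgue_on ?I)"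
      by (rule lebesgue_by_parts[OF \<eta> \<open>a < b\<close> test_function_DERIV[OF \<phi>]]) (use int in auto)
    moreover have "(\<integral>x. u x * deriv \<eta> x \<partial>lebesgue_on ?I) = - (\<integral>x. v x * \<eta> x \<partial>lebesgue_on ?I)"
      using u \<eta> by (auto simp: sobolev0_def sobolev_def)
    ultimately show ?thesis
      using integrable_mult_test_function[OF \<eta> \<open>a < b\<close>] int by (simp add: distrib_right)
  qed
  obtain \<psi> where \<psi>: "\<And>n::nat. test_function ?I (\<psi> n)"
    and lim: "(\<lambda>n. (\<integral>x. \<bar>\<psi> n x - u x\<bar> powr p \<partial>lebesgue_on ?I)
            + (\<integral>x. \<bar>deriv (\<psi> n) x - v x\<bar> powr p \<partial>lebesgue_on ?I)) \<longlonglongrightarrow> 0"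
    using u by (auto simp: sobolev0_def)
  have "deriv (\<lambda>x. \<psi> n x + \<phi> x) x = deriv (\<psi> n) x + deriv \<phi> x" for n x
    by (intro DERIV_imp_deriv DERIV_add test_function_DERIV[OF \<psi>] test_function_DERIV[OF \<phi>])
  then have "(\<lambda>n. (\<integral>x. \<bar>(\<psi> n x + \<phi> x) - (u x + \<phi> x)\<bar> powr p \<partial>lebesgue_on ?I)
      + (\<integral>x. \<bar>deriv (\<lambda>x. \<psi> n x + \<phi> x) x - (v x + deriv \<phi> x)\<bar> powr p \<partial>lebesgue_on ?I)) \<longlonglongrightarrow> 0"
    using lim by simp
  then show ?thesis
    unfolding sobolev0_def sobolev_def
    using weak Lp \<open>1 \<le> p\<close> test_function_add[OF \<psi> \<phi> \<open>a < b\<close>]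
    by (intro conjI exI[of _ "\<lambda>n x. \<psi> n x + \<phi> x"]) (auto intro!: Lp_on_add)
qed

text \<open>Multiplying out the quotient gives an inequality that also covers functions vanishing
  almost everywhere, so a variation of the minimizer can be inserted without checking that it is
  nonzero.\<close>

lemma first_eigenvalue_mult_le:
  assumes "sobolev0 p \<Omega> u v"
  shows "first_eigenvalue p \<Omega> * (\<integral>x. \<bar>u x\<bar> powr p \<partial>lebesgue_on \<Omega>) \<le> (\<integral>x. \<bar>v x\<bar> powr p \<partial>lebesgue_on \<Omega>)"
proof (cases "AE x in lebesgue_on \<Omega>. u x = 0")
  case True
  then have "(\<integral>x. \<bar>u x\<bar> powr p \<partial>lebesgue_on \<Omega>) = 0"
    by (intro integral_eq_zero_AE) auto
  then show ?thesis by simp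
next
  case False
  have int: "integrable (lebesgue_on \<Omega>) (\<lambda>x. \<bar>u x\<bar> powr p)"
    using assms by (auto simp: sobolev0_def sobolev_def Lp_on_def)
  have "(\<integral>x. \<bar>u x\<bar> powr p \<partial>lebesgue_on \<Omega>) \<noteq> 0"
    using False integral_nonneg_eq_0_iff_AE[OF int] by auto
  moreover have "0 \<le> (\<integral>x. \<bar>u x\<bar> powr p \<partial>lebesgue_on \<Omega>)" by simp
  ultimately have "0 < (\<integral>x. \<bar>u x\<bar> powr p \<partial>lebesgue_on \<Omega>)" by linarith
  moreover have "first_eigenvalue p \<Omega> \<le> rayleigh p \<Omega> u v"
    unfolding first_eigenvalue_def
    by (rule cInf_lower) (use assms False in \<open>auto intro!: bdd_belowI[of _ 0] simp: rayleigh_def\<close>)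
  ultimately show ?thesis
    by (simp add: rayleigh_def field_simps)
qed

text \<open>The odd power \<bar>s\<bar>^(r-1) s. For r = p - 1 it maps the gradient to the flux of
  the p-Laplacian, and for r > 0 its inverse is the same function with exponent 1 / r.\<close>

definition signed_powr :: "real \<Rightarrow> real \<Rightarrow> real" where
  "signed_powr r s = sgn s * \<bar>s\<bar> powr r"

text \<open>The only delicate point is 0, where the difference quotient has absolute value
  \<bar>h\<bar>^(p-1), which tends to 0 because p > 1.\<close>

lemma abs_powr_DERIV:
  assumes "1 < p"
  shows "((\<lambda>x. \<bar>x\<bar> powr p) has_real_derivative p * signed_powr (p - 1) x) (at x)"
proof -
  consider "x > 0" | "x < 0" | "x = 0" by linarith
  then show ?thesis
  proof cases
    case 1
    have "((\<lambda>x. x powr p) has_real_derivative p * signed_powr (p - 1) x) (at x)"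
      using 1 by (auto intro!: derivative_eq_intros simp: signed_powr_def)
    then show ?thesis
      by (rule has_field_derivative_transform_within_open[of _ _ _ "{0<..}"]) (use 1 in auto)
  next
    case 2
    have "((\<lambda>x. (- x) powr p) has_real_derivative p * signed_powr (p - 1) x) (at x)"
      using 2 by (auto intro!: derivative_eq_intros simp: signed_powr_def)
    then show ?thesis
      by (rule has_field_derivative_transform_within_open[of _ _ _ "{..<0}"]) (use 2 in auto)
  next
    case 3
    have "((\<lambda>h::real. \<bar>h\<bar> powr (p - 1)) \<longlongrightarrow> 0) (at 0)"
      using assms by (intro tendsto_eq_intros | simp)+
    then have "((\<lambda>h. \<bar>\<bar>h\<bar> powr p / h\<bar>) \<longlongrightarrow> 0) (at 0)"
      by (rule Lim_transform_eventually)
        (auto simp: eventually_at_filter powr_diff)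
    then have "((\<lambda>h. \<bar>h\<bar> powr p / h) \<longlongrightarrow> 0) (at 0)"
      using tendsto_rabs_zero_iff by blast
    then show ?thesis using 3 assms by (simp add: DERIV_def signed_powr_def)
  qed
qed

lemma abs_signed_powr: "\<bar>signed_powr r s\<bar> = \<bar>s\<bar> powr r"
  by (auto simp: signed_powr_def abs_mult sgn_real_def)

lemma signed_powr_measurable [measurable]:
  "f \<in> borel_measurable M \<Longrightarrow> (\<lambda>x. signed_powr r (f x)) \<in> borel_measurable M"
  by (simp add: signed_powr_def)

text \<open>The mean value theorem gives a majorant independent of \<open>t\<close>: since t \<le>
  1, the intermediate point is at most \<open>\<bar>a\<bar> + \<bar>b\<bar>\<close> in absolute
  value. This is what dominated convergence needs when differentiating under the integral.\<close>

lemma abs_powr_difference_le: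
  fixes a b p t :: real
  assumes "1 < p" "0 < t" "t \<le> 1"
  shows "\<bar>(\<bar>a + t * b\<bar> powr p - \<bar>a\<bar> powr p) / t\<bar> \<le> p * (2 powr p * (\<bar>a\<bar> powr p + \<bar>b\<bar> powr p))"
proof -
  have D: "((\<lambda>t. \<bar>a + t * b\<bar> powr p) has_real_derivative p * signed_powr (p - 1) (a + s * b) * b) (at s)" for s
    by (rule DERIV_chain2[OF abs_powr_DERIV[OF assms(1)]]) (auto intro!: derivative_eq_intros)
  obtain z where z: "0 < z" "z < t"
    "\<bar>a + t * b\<bar> powr p - \<bar>a + 0 * b\<bar> powr p = (t - 0) * (p * signed_powr (p - 1) (a + z * b) * b)"
    using MVT2[OF assms(2) D] by blast
  then have "\<bar>(\<bar>a + t * b\<bar> powr p - \<bar>a\<bar> powr p) / t\<bar> = p * \<bar>a + z * b\<bar> powr (p - 1) * \<bar>b\<bar>"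
    using assms by (simp add: abs_mult abs_signed_powr)
  also have "\<dots> \<le> p * (\<bar>a\<bar> + \<bar>b\<bar>) powr (p - 1) * (\<bar>a\<bar> + \<bar>b\<bar>)"
  proof (intro mult_mono mult_left_mono powr_mono2)
    have "\<bar>z * b\<bar> \<le> 1 * \<bar>b\<bar>" using z assms by (subst abs_mult, intro mult_right_mono) auto
    then show "\<bar>a + z * b\<bar> \<le> \<bar>a\<bar> + \<bar>b\<bar>" by linarith
  qed (use assms in auto)
  also have "\<dots> = p * (\<bar>\<bar>a\<bar> + \<bar>b\<bar>\<bar> powr p)"
    by (cases "\<bar>a\<bar> + \<bar>b\<bar> = 0") (auto simp: powr_diff)
  also have "\<dots> \<le> p * (2 powr p * (\<bar>a\<bar> powr p + \<bar>b\<bar> powr p))"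
    using assms abs_add_powr_le[of p "\<bar>a\<bar>" "\<bar>b\<bar>"] by simp
  finally show ?thesis .
qed

text \<open>Dominated convergence along the steps 1 / Suc n. A one-sided sequence is enough, because
  the sign of the variation is reversed later by passing from \<open>\<phi>\<close> to its
  negative.\<close>

lemma Lp_on_integral_derivative:
  assumes f: "Lp_on p \<Omega> f" and g: "Lp_on p \<Omega> g" and "1 < p"
  shows "(\<lambda>n. ((\<integral>x. \<bar>f x + 1 / Suc n * g x\<bar> powr p \<partial>lebesgue_on \<Omega>) - (\<integral>x. \<bar>f x\<bar> powr p \<partial>lebesgue_on \<Omega>)) / (1 / Suc n))
    \<longlonglongrightarrow> (\<integral>x. p * signed_powr (p - 1) (f x) * g x \<partial>lebesgue_on \<Omega>)"
    (is "?L \<longlonglongrightarrow> _")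
proof -
  have m: "f \<in> borel_measurable (lebesgue_on \<Omega>)" "g \<in> borel_measurable (lebesgue_on \<Omega>)"
    using f g by (auto simp: Lp_on_def)
  have "(\<lambda>n. \<integral>x. (\<bar>f x + 1 / Suc n * g x\<bar> powr p - \<bar>f x\<bar> powr p) / (1 / Suc n) \<partial>lebesgue_on \<Omega>)
    \<longlonglongrightarrow> (\<integral>x. p * signed_powr (p - 1) (f x) * g x \<partial>lebesgue_on \<Omega>)"
  proof (rule integral_dominated_convergence)
    show "integrable (lebesgue_on \<Omega>) (\<lambda>x. p * (2 powr p * (\<bar>f x\<bar> powr p + \<bar>g x\<bar> powr p)))"
      using f g by (auto simp: Lp_on_def)
    have "(\<lambda>n. (\<bar>f x + 1 / Suc n * g x\<bar> powr p - \<bar>f x\<bar> powr p) / (1 / Suc n))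
        \<longlonglongrightarrow> p * signed_powr (p - 1) (f x) * g x" for x
    proof -
      have "((\<lambda>t. \<bar>f x + t * g x\<bar> powr p) has_real_derivative p * signed_powr (p - 1) (f x + 0 * g x) * g x) (at 0)"
        by (rule DERIV_chain2[OF abs_powr_DERIV[OF assms(3)]]) (auto intro!: derivative_eq_intros)
      then have lim: "((\<lambda>t. (\<bar>f x + t * g x\<bar> powr p - \<bar>f x\<bar> powr p) / t) \<longlongrightarrow> p * signed_powr (p - 1) (f x) * g x) (at 0)"
        by (simp add: DERIV_def)
      have "filterlim (\<lambda>n. 1 / real (Suc n)) (at 0) sequentially"
        using LIMSEQ_inverse_real_of_nat by (auto simp: filterlim_at inverse_eq_divide)
      from filterlim_compose[OF lim this] show ?thesis .
    qed
    then show "AE x in lebesgue_on \<Omega>. (\<lambda>n. (\<bar>f x + 1 / Suc n * g x\<bar> powr p - \<bar>f x\<bar> powr p) / (1 / Suc n))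
        \<longlonglongrightarrow> p * signed_powr (p - 1) (f x) * g x" by blast
    have "norm ((\<bar>f x + 1 / Suc n * g x\<bar> powr p - \<bar>f x\<bar> powr p) / (1 / Suc n))
      \<le> p * (2 powr p * (\<bar>f x\<bar> powr p + \<bar>g x\<bar> powr p))" for n x
      unfolding real_norm_def by (rule abs_powr_difference_le[OF assms(3)]) auto
    then show "AE x in lebesgue_on \<Omega>. norm ((\<bar>f x + 1 / Suc n * g x\<bar> powr p - \<bar>f x\<bar> powr p) / (1 / Suc n))
      \<le> p * (2 powr p * (\<bar>f x\<bar> powr p + \<bar>g x\<bar> powr p))" for n by blast
  qed (use m in measurable)
  moreover have "integrable (lebesgue_on \<Omega>) (\<lambda>x. \<bar>f x + 1 / Suc n * g x\<bar> powr p)" for n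
    using Lp_on_add[OF f Lp_on_cmult[OF g, of "1 / Suc n"]] \<open>1 < p\<close> by (auto simp: Lp_on_def)
  moreover have "integrable (lebesgue_on \<Omega>) (\<lambda>x. \<bar>f x\<bar> powr p)"
    using f by (auto simp: Lp_on_def)
  ultimately show ?thesis by simp
qed

text \<open>The function \<open>E t - ?l * N t\<close> is nonnegative and vanishes at t = 0, so its
  right derivative there is nonnegative. This gives \<open>le\<close>; applying it to
  \<open>\<phi>\<close> and to its negative yields equality.\<close>

lemma euler_lagrange:
  assumes u: "sobolev0 p {a<..<b} u v" and "1 < p" "a < b"
    and min: "(\<integral>x. \<bar>v x\<bar> powr p \<partial>lebesgue_on {a<..<b}) = first_eigenvalue p {a<..<b} * (\<integral>x. \<bar>u x\<bar> powr p \<partial>lebesgue_on {a<..<b})"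
    and \<phi>: "test_function {a<..<b} \<phi>"
  shows "(\<integral>x. signed_powr (p - 1) (v x) * deriv \<phi> x \<partial>lebesgue_on {a<..<b})
    = first_eigenvalue p {a<..<b} * (\<integral>x. signed_powr (p - 1) (u x) * \<phi> x \<partial>lebesgue_on {a<..<b})"
proof -
  let ?I = "{a<..<b}" and ?l = "first_eigenvalue p {a<..<b}"
  have Lp: "Lp_on p ?I u" "Lp_on p ?I v"
    using u by (auto simp: sobolev0_def sobolev_def)
  have le: "?l * (\<integral>x. signed_powr (p - 1) (u x) * \<phi> x \<partial>lebesgue_on ?I)
      \<le> (\<integral>x. signed_powr (p - 1) (v x) * deriv \<phi> x \<partial>lebesgue_on ?I)"
    if \<phi>: "test_function ?I \<phi>" for \<phi>
  proof -
    have d: "deriv (\<lambda>x. t * \<phi> x) x = t * deriv \<phi> x" for t x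
      by (intro DERIV_imp_deriv DERIV_cmult test_function_DERIV[OF \<phi>])
    define E where "E t = (\<integral>x. \<bar>v x + t * deriv \<phi> x\<bar> powr p \<partial>lebesgue_on ?I)" for t
    define N where "N t = (\<integral>x. \<bar>u x + t * \<phi> x\<bar> powr p \<partial>lebesgue_on ?I)" for t
    have "?l * N t \<le> E t" for t
      using first_eigenvalue_mult_le[OF sobolev0_add_test_function[OF u _ _ test_function_cmult[OF \<phi>, of t]]] assms(2,3)
      by (simp add: d E_def N_def)
    moreover have "E 0 = ?l * N 0" using min by (simp add: E_def N_def)
    ultimately have "0 \<le> (E t - E 0) - ?l * (N t - N 0)" for t
      by (simp add: algebra_simps)
    then have "0 \<le> ((E t - E 0) - ?l * (N t - N 0)) / t" if "t > 0" for t
      using that by simp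
    then have "0 \<le> (E t - E 0) / t - ?l * ((N t - N 0) / t)" if "t > 0" for t
      using that by (metis diff_divide_distrib times_divide_eq_right)
    then have nonneg: "0 \<le> (E (1 / Suc n) - E 0) / (1 / Suc n) - ?l * ((N (1 / Suc n) - N 0) / (1 / Suc n))" for n :: nat
      by (meson of_nat_0_less_iff zero_less_Suc zero_less_divide_1_iff)
    have "(\<lambda>n. (E (1 / Suc n) - E 0) / (1 / Suc n) - ?l * ((N (1 / Suc n) - N 0) / (1 / Suc n))) \<longlonglongrightarrow>
      (\<integral>x. p * signed_powr (p - 1) (v x) * deriv \<phi> x \<partial>lebesgue_on ?I)
      - ?l * (\<integral>x. p * signed_powr (p - 1) (u x) * \<phi> x \<partial>lebesgue_on ?I)"
      unfolding E_def N_def mult_zero_left add_0_right using Lp test_function_Lp[OF \<phi> \<open>a < b\<close>, of p] \<open>1 < p\<close>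
      by (intro tendsto_diff tendsto_mult tendsto_const Lp_on_integral_derivative) auto
    from LIMSEQ_le_const[OF this] nonneg
    have "0 \<le> (\<integral>x. p * signed_powr (p - 1) (v x) * deriv \<phi> x \<partial>lebesgue_on ?I)
      - ?l * (\<integral>x. p * signed_powr (p - 1) (u x) * \<phi> x \<partial>lebesgue_on ?I)"
      by blast
    then have "0 \<le> p * ((\<integral>x. signed_powr (p - 1) (v x) * deriv \<phi> x \<partial>lebesgue_on ?I)
      - ?l * (\<integral>x. signed_powr (p - 1) (u x) * \<phi> x \<partial>lebesgue_on ?I))"
      by (simp add: mult.assoc right_diff_distrib mult.left_commute)
    then show ?thesis using \<open>1 < p\<close> by (simp add: zero_le_mult_iff)
  qed
  have "deriv (\<lambda>x. - \<phi> x) x = - deriv \<phi> x" for x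
    by (intro DERIV_imp_deriv DERIV_minus test_function_DERIV[OF \<phi>])
  then show ?thesis
    using le[OF \<phi>] le[of "\<lambda>x. - \<phi> x"] test_function_cmult[OF \<phi> \<open>a < b\<close>, of "-1"] by simp
qed

section \<open>The lemma of du Bois-Reymond\<close>

text \<open>Open intervals are stable under intersection and generate the Borel sets, so the
  vanishing of the integral spreads to every Borel set by a Dynkin argument. The vanishing total
  integral \<open>0\<close> handles complements.\<close>

lemma AE_eq_zero_if_box_integrals_zero:
  fixes f :: "real \<Rightarrow> real"
  assumes f: "integrable lebesgue f" and 0: "integral\<^sup>L lebesgue f = 0"
    and box: "\<And>c d. c < d \<Longrightarrow> (\<integral>x. indicator {c<..<d} x * f x \<partial>lebesgue) = 0"
  shows "AE x in lebesgue. f x = 0"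
proof -
  \<comment> \<open>The intervals generate the Borel sets but not all Lebesgue sets, so
    \<open>f\<close> is replaced by a Borel function equal to it almost everywhere.\<close>
  obtain g where g: "g \<in> borel_measurable lborel" and fg: "AE x in lborel. f x = g x"
    using completion_ex_borel_measurable_real[OF borel_measurable_integrable[OF f]] by auto
  have fg': "AE x in lebesgue. f x = g x" using fg by (rule AE_completion)
  have gl: "g \<in> borel_measurable lebesgue" using g by (rule measurable_completion)
  have "integrable lebesgue g"
    using integrable_cong_AE[OF borel_measurable_integrable[OF f] gl fg'] f by blast
  then have ig: "integrable lborel g" using integrable_completion[OF g] by blast
  have eq: "(\<integral>x\<in>A. g x \<partial>lborel) = (\<integral>x. indicator A x * f x \<partial>lebesgue)" if A: "A \<in> sets borel" for A
  proof -
    have "(\<integral>x\<in>A. g x \<partial>lborel) = (\<integral>x. indicator A x * g x \<partial>lebesgue)"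
      unfolding set_lebesgue_integral_def using g A by (subst integral_completion) auto
    also have "\<dots> = (\<integral>x. indicator A x * f x \<partial>lebesgue)"
    proof (rule integral_cong_AE)
      show "(\<lambda>x. indicator A x * g x) \<in> borel_measurable lebesgue"
        using gl A by (intro borel_measurable_times borel_measurable_indicator) auto
      show "(\<lambda>x. indicator A x * f x) \<in> borel_measurable lebesgue"
        using f A by (intro borel_measurable_times borel_measurable_indicator) auto
      show "AE x in lebesgue. indicator A x * g x = indicator A x * f x"
        using fg' by eventually_elim auto
    qed
    finally show ?thesis .
  qed
  have si: "set_integrable lborel A g" if "A \<in> sets borel" for A
    unfolding set_integrable_def using that by (intro integrable_mult_indicator ig) simp
  have "AE x in lborel. g x = 0"
  proof (rule sigma_finite_measure.density_zero[OF lborel.sigma_finite_measure_axioms ig])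
    fix A :: "real set" assume "A \<in> sets lborel"
    have "Int_stable (range (\<lambda>(a, b). box a b :: real set))"
      by (auto simp: Int_stable_def box_Int_box)
    moreover have "range (\<lambda>(a, b). box a b :: real set) \<subseteq> Pow UNIV" by auto
    moreover have "A \<in> sigma_sets UNIV (range (\<lambda>(a, b). box a b))"
      using \<open>A \<in> sets lborel\<close> unfolding sets_lborel borel_eq_box by (simp del: box_real)
    ultimately show "(\<integral>x\<in>A. g x \<partial>lborel) = 0"
    proof (induction rule: sigma_sets_induct_disjoint)
      case (basic A)
      then obtain c d where A: "A = {c<..<d}" by auto
      show ?case
      proof (cases "c < d")
        case True
        then show ?thesis using eq[of A] box A by simp
      qed (simp add: A set_lebesgue_integral_def)
    next
      case (compl A)
      then have A: "A \<in> sets borel" by (simp add: borel_eq_box)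
      have "(\<integral>x\<in>UNIV. g x \<partial>lborel) = (\<integral>x\<in>A. g x \<partial>lborel) + (\<integral>x\<in>UNIV - A. g x \<partial>lborel)"
        using set_integral_Un[OF _ si[OF A] si, of "UNIV - A"] A by simp
      moreover have "(\<integral>x\<in>UNIV. g x \<partial>lborel) = 0" using eq[of UNIV] 0 by simp
      ultimately show ?case using compl by simp
    next
      case (union F)
      then have F: "F i \<in> sets lborel" for i by (auto simp: borel_eq_box subset_eq)
      have "(\<integral>x\<in>(\<Union>i. F i). g x \<partial>lborel) = (\<Sum>i. (\<integral>x\<in>F i. g x \<partial>lborel))"
      proof (rule lebesgue_integral_countable_add)
        show "set_integrable lborel (\<Union>i. F i) g"
          using F by (intro si) auto
      qed (use F union in \<open>auto simp: disjoint_family_on_def\<close>)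
      then show ?case using union by simp
    qed (simp add: set_lebesgue_integral_def)
  qed
  then have "AE x in lebesgue. g x = 0" by (rule AE_completion)
  with fg' show ?thesis by eventually_elim simp
qed

section \<open>Bumps as approximate indicators and the variational argument\<close>

lemma bump_bounds: "0 \<le> \<epsilon> \<Longrightarrow> 0 \<le> bump \<epsilon> c d x \<and> bump \<epsilon> c d x \<le> 1"
  by (auto simp: bump_def mult_nonneg_nonneg)

text \<open>Both parameters shrink together: the inset 1 / Suc n keeps the support compactly inside
  the open interval, even when this is all of (a, b), and the factor 1 / Suc n sends the exponent to
  0.\<close>

lemma bump_tendsto_indicator:
  "(\<lambda>n. bump (1 / Suc n) (c + 1 / Suc n) (d - 1 / Suc n) x) \<longlonglongrightarrow> indicator {c<..<d} x"
proof (cases "x \<in> {c<..<d}")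
  case False
  have "bump (1 / Suc n) (c + 1 / Suc n) (d - 1 / Suc n) x = 0" for n
  proof -
    have "0 < 1 / real (Suc n)" by simp
    with False have "\<not> (c + 1 / Suc n < x \<and> x < d - 1 / Suc n)"
      unfolding greaterThanLessThan_iff by linarith
    then show ?thesis by (simp add: bump_def)
  qed
  with False show ?thesis by simp
next
  case True
  have lim: "(\<lambda>n. 1 / real (Suc n)) \<longlonglongrightarrow> 0"
    using LIMSEQ_inverse_real_of_nat by (simp add: inverse_eq_divide)
  have "(\<lambda>n. exp (- (1 / Suc n) * (1 / (x - (c + 1 / Suc n)) + 1 / ((d - 1 / Suc n) - x)))) \<longlonglongrightarrow>
      exp (- 0 * (1 / (x - (c + 0)) + 1 / ((d - 0) - x)))"
    using True by (intro tendsto_intros lim) auto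
  moreover have "eventually (\<lambda>n. 1 / real (Suc n) < min (x - c) (d - x)) sequentially"
    using True by (intro order_tendstoD[OF lim]) auto
  then have "eventually (\<lambda>n. exp (- (1 / Suc n) * (1 / (x - (c + 1 / Suc n)) + 1 / ((d - 1 / Suc n) - x)))
      = bump (1 / Suc n) (c + 1 / Suc n) (d - 1 / Suc n) x) sequentially"
    by eventually_elim (auto simp: bump_def)
  ultimately have "(\<lambda>n. bump (1 / Suc n) (c + 1 / Suc n) (d - 1 / Suc n) x) \<longlonglongrightarrow>
      exp (- 0 * (1 / (x - (c + 0)) + 1 / ((d - 0) - x)))"
    by (rule Lim_transform_eventually)
  with True show ?thesis by simp
qed

text \<open>The zero mean brings the antiderivative back to its initial value at the right end, so
  after subtracting \<open>F a\<close> it vanishes on both sides of \<open>{c..d}\<close>.\<close>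

lemma ex_test_function_antiderivative:
  assumes "smooth \<psi>" and sub: "a < c" "c \<le> d" "d < b"
    and zero: "\<And>x. x \<notin> {c..d} \<Longrightarrow> \<psi> x = 0"
    and int: "integral {a..b} \<psi> = 0"
  obtains \<phi> where "test_function {a<..<b} \<phi>" "deriv \<phi> = \<psi>"
proof -
  have cont: "isCont \<psi> x" for x
    using smooth_DERIV[OF assms(1)] by (rule DERIV_isCont)
  have "\<exists>F. \<forall>x::real. -\<infinity> < ereal x \<longrightarrow> ereal x < \<infinity> \<longrightarrow> (F has_vector_derivative \<psi> x) (at x)"
    by (rule einterval_antiderivative) (simp_all add: cont)
  then obtain F where F: "\<And>x. (F has_real_derivative \<psi> x) (at x)"
    by (auto simp: has_real_derivative_iff_has_vector_derivative)
  have FTC: "(\<psi> has_integral (F y - F x)) {x..y}" if "x \<le> y" for x y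
  proof (rule fundamental_theorem_of_calculus[OF that])
    show "(F has_vector_derivative \<psi> z) (at z within {x..y})" for z
      using F[of z] by (simp add: has_real_derivative_iff_has_vector_derivative has_vector_derivative_at_within)
  qed
  have const: "F x = F y" if "x \<le> y" "{x..y} \<inter> {c..d} = {}" for x y
  proof -
    have "(\<psi> has_integral 0) {x..y}"
      using that(2) zero by (intro has_integral_is_0) blast
    then have "F y - F x = 0" by (rule has_integral_unique[OF FTC[OF that(1)]])
    then show ?thesis by simp
  qed
  have ab: "F b = F a"
    using FTC[of a b] int sub by (simp add: integral_unique)
  have off: "F x - F a = 0" if "x \<notin> {c..d}" for x
  proof (cases "x < c")
    case True
    then have "F (min x a) = F (max x a)" using \<open>a < c\<close> by (intro const) auto
    then show ?thesis by (cases "x \<le> a") auto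
  next
    case False
    then have "x > d" using that by auto
    then have "F (min x b) = F (max x b)" using \<open>d < b\<close> by (intro const) auto
    then show ?thesis using ab by (cases "x \<le> b") auto
  qed
  have D: "((\<lambda>x. F x - F a) has_real_derivative \<psi> x) (at x)" for x
    using DERIV_diff[OF F DERIV_const[of "F a"]] by simp
  then have "deriv (\<lambda>x. F x - F a) = \<psi>"
    by (intro ext DERIV_imp_deriv)
  moreover have "test_function {a<..<b} (\<lambda>x. F x - F a)"
  proof (rule test_functionI[of _ c d])
    show "smooth (\<lambda>x. F x - F a)"
      by (rule smooth_antiderivative[OF D assms(1)])
    show "{c..d} \<subseteq> {a<..<b}" using sub by auto
  qed (rule off)
  ultimately show ?thesis using that by blast
qed

text \<open>Two bumps, each weighted by the integral of the other, have a difference of mean zero,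
  which is the derivative of a test function. Letting the bumps tend to indicators shows that the
  integral of \<open>g\<close> over a subinterval is proportional to its length, so \<open>g\<close>
  is almost everywhere its own mean \<open>k\<close>.\<close>

lemma du_bois_reymond:
  assumes "a < b" and g: "integrable (lebesgue_on {a<..<b}) g"
    and weak: "\<And>\<phi>. test_function {a<..<b} \<phi> \<Longrightarrow> (\<integral>x. g x * deriv \<phi> x \<partial>lebesgue_on {a<..<b}) = 0"
  obtains k where "AE x in lebesgue_on {a<..<b}. g x = k"
proof -
  let ?M = "lebesgue_on {a<..<b}"
  interpret finite_measure ?M by (rule finite_measure_lebesgue_on_Ioo)
  define B where "B n c d = bump (1 / real (Suc n)) (c + 1 / Suc n) (d - 1 / Suc n)" for n c d
  have B_zero: "B n c d x = 0" if "x \<notin> {c + 1 / Suc n..d - 1 / Suc n}" for n c d x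
    using that by (auto simp: B_def bump_def)
  have smooth_B: "smooth (B n c d)" for n c d
    unfolding B_def by (rule smooth_bump) auto
  have B_meas: "B n c d \<in> borel_measurable ?M" for n c d
    by (intro continuous_imp_measurable_on_sets_lebesgue smooth_continuous_on smooth_B) auto
  have B_le: "\<bar>B n c d x\<bar> \<le> 1" for n c d x
    using bump_bounds[of "1 / real (Suc n)"] by (simp add: B_def)
  have ind: "(indicator {c<..<d} :: real \<Rightarrow> real) \<in> borel_measurable ?M" for c d
    by (intro measurable_restrict_space1 borel_measurable_indicator) auto
  have B_lim: "(\<lambda>n. \<integral>x. f x * B n c d x \<partial>?M) \<longlonglongrightarrow> (\<integral>x. f x * indicator {c<..<d} x \<partial>?M)"
    if "integrable ?M f" for f c d
  proof (rule integral_dominated_convergence[where w = "\<lambda>x. \<bar>f x\<bar>"])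
    show "AE x in ?M. (\<lambda>n. f x * B n c d x) \<longlonglongrightarrow> f x * indicator {c<..<d} x"
      unfolding B_def by (intro AE_I2 tendsto_mult tendsto_const bump_tendsto_indicator)
    show "AE x in ?M. norm (f x * B n c d x) \<le> \<bar>f x\<bar>" for n
      using B_le[of n c d] by (intro AE_I2) (simp add: abs_mult mult_left_le)
    show "(\<lambda>x. f x * B n c d x) \<in> borel_measurable ?M" for n
      using that B_meas by (intro borel_measurable_times) auto
    show "(\<lambda>x. f x * indicator {c<..<d} x) \<in> borel_measurable ?M"
      using that by (intro borel_measurable_times ind) auto
  qed (use that in auto)
  have B_int: "integrable ?M (\<lambda>x. f x * B n c d x)" if "integrable ?M f" for f n c d
    by (rule integrable_mult_bounded[OF that B_meas B_le])
  have one: "integrable ?M (\<lambda>x. 1 :: real)" by simp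
  have B_integral: "integral {a..b} (B n c d) = (\<integral>x. B n c d x \<partial>?M)" for n c d
    using lebesgue_integral_eq_integral[of "{a<..<b}" "B n c d"] B_int[OF one, of n c d]
    by (simp add: integral_open_interval_real)
  \<comment> \<open>The cross-multiplied form avoids dividing by the integral of a bump, which is 0
    when the insets exhaust the interval, as may happen for small \<open>n\<close>.\<close>
  have swap: "(\<integral>x. B n c' d' x \<partial>?M) * (\<integral>x. g x * B n c d x \<partial>?M) = (\<integral>x. B n c d x \<partial>?M) * (\<integral>x. g x * B n c' d' x \<partial>?M)"
    if cd: "a \<le> c" "d \<le> b" "a \<le> c'" "d' \<le> b" for n c d c' d'
  proof (cases "{c + 1 / Suc n..d - 1 / Suc n} = {} \<or> {c' + 1 / Suc n..d' - 1 / Suc n} = {}")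
    case True
    then have "B n c d = (\<lambda>x. 0) \<or> B n c' d' = (\<lambda>x. 0)" using B_zero by auto
    then show ?thesis by auto
  next
    case False
    define \<alpha> where "\<alpha> = (\<integral>x. B n c' d' x \<partial>?M)"
    define \<beta> where "\<beta> = (\<integral>x. B n c d x \<partial>?M)"
    obtain \<phi> where \<phi>: "test_function {a<..<b} \<phi>" "deriv \<phi> = (\<lambda>x. \<alpha> * B n c d x + - \<beta> * B n c' d' x)"
    proof (rule ex_test_function_antiderivative)
      show "smooth (\<lambda>x. \<alpha> * B n c d x + - \<beta> * B n c' d' x)"
        by (intro smooth_add smooth_mult smooth_const smooth_B)
      have B_has: "(B n c d has_integral (\<integral>x. B n c d x \<partial>?M)) {a..b}" for c d
        unfolding B_integral[symmetric]
        by (intro integrable_integral integrable_continuous_interval smooth_continuous_on smooth_B)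
      have "((\<lambda>x. \<alpha> * B n c d x + - \<beta> * B n c' d' x) has_integral (\<alpha> * \<beta> + - \<beta> * \<alpha>)) {a..b}"
        unfolding \<alpha>_def \<beta>_def by (intro has_integral_add has_integral_mult_right B_has)
      then show "integral {a..b} (\<lambda>x. \<alpha> * B n c d x + - \<beta> * B n c' d' x) = 0"
        by (simp add: integral_unique)
      show "a < a + 1 / Suc n" "b - 1 / Suc n < b" by auto
      show "a + 1 / Suc n \<le> b - 1 / Suc n" using False cd by auto
      fix x assume "x \<notin> {a + 1 / Suc n..b - 1 / Suc n}"
      then have "x \<notin> {c + 1 / Suc n..d - 1 / Suc n}" "x \<notin> {c' + 1 / Suc n..d' - 1 / Suc n}"
        using cd by auto
      then show "\<alpha> * B n c d x + - \<beta> * B n c' d' x = 0" by (simp add: B_zero)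
    qed
    have "0 = (\<integral>x. g x * (\<alpha> * B n c d x + - \<beta> * B n c' d' x) \<partial>?M)"
      using weak[OF \<phi>(1)] \<phi>(2) by simp
    also have "\<dots> = (\<integral>x. \<alpha> * (g x * B n c d x) - \<beta> * (g x * B n c' d' x) \<partial>?M)"
      by (intro Bochner_Integration.integral_cong) (auto simp: algebra_simps)
    also have "\<dots> = \<alpha> * (\<integral>x. g x * B n c d x \<partial>?M) - \<beta> * (\<integral>x. g x * B n c' d' x \<partial>?M)"
      using B_int[OF g] by simp
    finally show ?thesis by (simp add: \<alpha>_def \<beta>_def)
  qed
  have B_lim1: "(\<lambda>n. \<integral>x. B n c d x \<partial>?M) \<longlonglongrightarrow> (\<integral>x. indicator {c<..<d} x \<partial>?M)" for c d
    using B_lim[OF one, of c d] by simp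
  have meas: "(\<integral>x. indicator {c<..<d} x \<partial>?M) = max 0 (d - c)" if "a \<le> c" "d \<le> b" for c d
  proof -
    have "{c<..<d} \<inter> space ?M = {c<..<d}" using that by auto
    then have "(\<integral>x. indicator {c<..<d} x \<partial>?M) = measure ?M {c<..<d}" by simp
    also have "\<dots> = measure lebesgue {c<..<d}"
      using that by (intro measure_restrict_space) auto
    finally show ?thesis by (cases "c \<le> d") auto
  qed
  have key: "(b - a) * (\<integral>x. g x * indicator {c<..<d} x \<partial>?M) = (d - c) * (\<integral>x. g x * indicator {a<..<b} x \<partial>?M)"
    if "a \<le> c" "d \<le> b" "c < d" for c d
  proof -
    note L1 = tendsto_mult[OF B_lim1[of a b] B_lim[OF g, of c d]]
    note L2 = tendsto_mult[OF B_lim1[of c d] B_lim[OF g, of a b]]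
    have "(\<integral>x. indicator {a<..<b} x \<partial>?M) * (\<integral>x. g x * indicator {c<..<d} x \<partial>?M)
        = (\<integral>x. indicator {c<..<d} x \<partial>?M) * (\<integral>x. g x * indicator {a<..<b} x \<partial>?M)"
      using L1 L2 unfolding swap[OF that(1,2) order_refl order_refl] by (rule LIMSEQ_unique)
    then show ?thesis
      unfolding meas[OF order_refl order_refl] meas[OF that(1,2)] using that \<open>a < b\<close> by simp
  qed
  define k where "k = (\<integral>x. g x * indicator {a<..<b} x \<partial>?M) / (b - a)"
  have key': "(\<integral>x. (g x - k) * indicator {c<..<d} x \<partial>?M) = 0" for c d
  proof -
    \<comment> \<open>The intervals range over the whole line, while \<open>key\<close> is about
      subintervals of (a, b); clipping does not change the integral over (a, b).\<close>
    define c' where "c' = max a c"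
    define d' where "d' = min b d"
    have "(\<integral>x. (g x - k) * indicator {c<..<d} x \<partial>?M) = (\<integral>x. (g x - k) * indicator {c'<..<d'} x \<partial>?M)"
      by (intro Bochner_Integration.integral_cong) (auto simp: c'_def d'_def indicator_def)
    also have "\<dots> = 0"
    proof (cases "c' < d'")
      case True
      have i: "integrable ?M (\<lambda>x. f x * indicator {c'<..<d'} x)" if "integrable ?M f" for f :: "real \<Rightarrow> real"
        by (rule integrable_mult_bounded[OF that ind, where B = 1]) (auto simp: indicator_def)
      have "(\<integral>x. (g x - k) * indicator {c'<..<d'} x \<partial>?M)
          = (\<integral>x. g x * indicator {c'<..<d'} x \<partial>?M) - k * (\<integral>x. indicator {c'<..<d'} x \<partial>?M)"
        using i[OF g] i[OF one] by (simp add: left_diff_distrib)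
      also have "\<dots> = 0"
      proof -
        have le: "a \<le> c'" "d' \<le> b" by (auto simp: c'_def d'_def)
        have "(\<integral>x. g x * indicator {c'<..<d'} x \<partial>?M) = (d' - c') * k"
          using key[OF le True] \<open>a < b\<close> unfolding k_def by (simp add: eq_divide_eq mult.commute)
        moreover have "(\<integral>x. indicator {c'<..<d'} x \<partial>?M) = d' - c'"
          using meas[OF le] True by linarith
        ultimately show ?thesis by (simp only: mult.commute diff_self)
      qed
      finally show ?thesis .
    qed simp
    finally show ?thesis .
  qed
  let ?h = "\<lambda>x. indicator {a<..<b} x * (g x - k)"
  have "AE x in lebesgue. ?h x = 0"
  proof (rule AE_eq_zero_if_box_integrals_zero)
    have I: "{a<..<b} \<inter> space lebesgue \<in> sets lebesgue" by simp
    have restrict: "integral\<^sup>L ?M f = (\<integral>x. indicator {a<..<b} x * f x \<partial>lebesgue)" for f :: "real \<Rightarrow> real"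
      using integral_restrict_space[OF I, of f] by (simp only: real_scaleR_def)
    have gk: "integrable ?M (\<lambda>x. g x - k)" using g by simp
    show "integrable lebesgue ?h"
      using gk unfolding integrable_restrict_space[OF I] real_scaleR_def .
    have "integral\<^sup>L lebesgue ?h = (\<integral>x. g x - k \<partial>?M)"
      by (rule restrict[symmetric])
    also have "\<dots> = (\<integral>x. (g x - k) * indicator {a<..<b} x \<partial>?M)"
      by (intro Bochner_Integration.integral_cong) auto
    finally show "integral\<^sup>L lebesgue ?h = 0" using key'[of a b] by simp
    fix c d :: real
    have "(\<integral>x. indicator {c<..<d} x * ?h x \<partial>lebesgue) = (\<integral>x. (g x - k) * indicator {c<..<d} x \<partial>?M)"
      unfolding restrict by (simp only: mult_ac)
    then show "(\<integral>x. indicator {c<..<d} x * ?h x \<partial>lebesgue) = 0"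
      by (simp only: key')
  qed
  then have "AE x in lebesgue. x \<in> {a<..<b} \<longrightarrow> g x = k"
    by eventually_elim auto
  then have "AE x in ?M. g x = k"
    by (subst AE_restrict_space_iff) auto
  then show ?thesis by (rule that)
qed

section \<open>Primitives of weak derivatives\<close>

text \<open>Integrating the bound \<open>pw\<close> splits the L^1 norm into a part made small by
  the choice of \<open>e\<close> and a part that tends to 0 for this fixed \<open>e\<close>.\<close>

lemma Lp_tendsto_imp_L1_tendsto:
  assumes Lp: "\<And>n::nat. Lp_on p \<Omega> (f n)" and "1 \<le> p" and \<Omega>: "\<Omega> \<in> lmeasurable"
    and lim: "(\<lambda>n. \<integral>x. \<bar>f n x\<bar> powr p \<partial>lebesgue_on \<Omega>) \<longlonglongrightarrow> 0"
  shows "(\<lambda>n. \<integral>x. \<bar>f n x\<bar> \<partial>lebesgue_on \<Omega>) \<longlonglongrightarrow> 0"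
proof -
  let ?M = "lebesgue_on \<Omega>"
  interpret finite_measure ?M by (rule finite_measure_lebesgue_on[OF \<Omega>])
  define m where "m = measure ?M (space ?M)"
  have m: "0 \<le> m" by (simp add: m_def)
  \<comment> \<open>This elementary bound replaces the Hoelder inequality.\<close>
  have pw: "\<bar>t\<bar> \<le> e + e powr (1 - p) * \<bar>t\<bar> powr p" if "0 < e" for e t :: real
  proof (cases "\<bar>t\<bar> \<le> e")
    case True
    then show ?thesis by (simp add: add_increasing2)
  next
    case False
    then have "\<bar>t\<bar> powr (1 - p) \<le> e powr (1 - p)" using that \<open>1 \<le> p\<close> by (intro powr_mono2') auto
    then have "\<bar>t\<bar> powr (1 - p) * \<bar>t\<bar> powr p \<le> e powr (1 - p) * \<bar>t\<bar> powr p" by (rule mult_right_mono) simp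
    moreover have "\<bar>t\<bar> powr (1 - p) * \<bar>t\<bar> powr p = \<bar>t\<bar>" using False that by (subst powr_add[symmetric]) auto
    ultimately show ?thesis using that by linarith
  qed
  have le: "(\<integral>x. \<bar>f n x\<bar> \<partial>?M) \<le> e * m + e powr (1 - p) * (\<integral>x. \<bar>f n x\<bar> powr p \<partial>?M)" if "0 < e" for e n
  proof -
    have i: "integrable ?M (\<lambda>x. \<bar>f n x\<bar> powr p)" using Lp[of n] by (simp add: Lp_on_def)
    have "(\<integral>x. \<bar>f n x\<bar> \<partial>?M) \<le> (\<integral>x. e + e powr (1 - p) * \<bar>f n x\<bar> powr p \<partial>?M)"
      using i pw[OF that] by (intro integral_mono integrable_abs Lp_on_imp_integrable[OF Lp \<open>1 \<le> p\<close> \<Omega>]) auto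
    also have "\<dots> = e * m + e powr (1 - p) * (\<integral>x. \<bar>f n x\<bar> powr p \<partial>?M)"
      using i by (simp add: m_def mult.commute)
    finally show ?thesis .
  qed
  show ?thesis
  proof (rule order_tendstoI)
    fix e :: real assume "0 < e"
    \<comment> \<open>This choice gives \<open>d * m < e\<close>; the summand 1 covers a set of
      measure zero, where \<open>m = 0\<close>.\<close>
    define d where "d = e / (2 * (m + 1))"
    have d0: "0 < d" using \<open>0 < e\<close> m by (simp add: d_def)
    have "d * (2 * (m + 1)) = e" using m by (simp add: d_def)
    moreover have "0 \<le> d * m" using d0 m by simp
    ultimately have d: "0 < d" "d * m < e" using d0 by (auto simp: distrib_left)
    have "(\<lambda>n. d * m + d powr (1 - p) * (\<integral>x. \<bar>f n x\<bar> powr p \<partial>?M)) \<longlonglongrightarrow> d * m + d powr (1 - p) * 0"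
      by (intro tendsto_intros lim)
    then have "eventually (\<lambda>n. d * m + d powr (1 - p) * (\<integral>x. \<bar>f n x\<bar> powr p \<partial>?M) < e) sequentially"
      by (rule order_tendstoD) (use d in simp)
    then show "eventually (\<lambda>n. (\<integral>x. \<bar>f n x\<bar> \<partial>?M) < e) sequentially"
      by eventually_elim (rule le_less_trans[OF le[OF d(1)]])
  next
    fix e :: real assume "e < 0"
    have "e < (\<integral>x. \<bar>f n x\<bar> \<partial>?M)" for n
      using \<open>e < 0\<close> by (rule less_le_trans) simp
    then show "eventually (\<lambda>n. e < (\<integral>x. \<bar>f n x\<bar> \<partial>?M)) sequentially" by simp
  qed
qed

text \<open>The upper limit enters through an indicator, so the measure space does not depend on
  \<open>x\<close>. Estimates uniform in \<open>x\<close> and dominated convergence in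
  \<open>x\<close> then apply directly, also at the end points.\<close>

definition primitive :: "real \<Rightarrow> real \<Rightarrow> (real \<Rightarrow> real) \<Rightarrow> real \<Rightarrow> real" where
  "primitive a b f x = (\<integral>t. f t * indicator {..x} t \<partial>lebesgue_on {a<..<b})"

lemma indicator_measurable_lebesgue_on:
  "A \<in> sets borel \<Longrightarrow> (indicator A :: real \<Rightarrow> real) \<in> borel_measurable (lebesgue_on S)"
  by (intro measurable_restrict_space1 borel_measurable_indicator) auto

lemma integrable_mult_indicator_lebesgue_on:
  fixes f :: "real \<Rightarrow> real"
  assumes "integrable (lebesgue_on S) f" "A \<in> sets borel"
  shows "integrable (lebesgue_on S) (\<lambda>t. f t * indicator A t)"
  by (rule integrable_mult_bounded[OF assms(1) indicator_measurable_lebesgue_on[OF assms(2)], where B = 1])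
    (auto simp: indicator_def)

lemma abs_primitive_le:
  assumes "integrable (lebesgue_on {a<..<b}) f"
  shows "\<bar>primitive a b f x\<bar> \<le> (\<integral>t. \<bar>f t\<bar> \<partial>lebesgue_on {a<..<b})"
proof -
  have "\<bar>primitive a b f x\<bar> \<le> (\<integral>t. \<bar>f t * indicator {..x} t\<bar> \<partial>lebesgue_on {a<..<b})"
    unfolding primitive_def by (rule integral_abs_bound)
  also have "\<dots> \<le> (\<integral>t. \<bar>f t\<bar> \<partial>lebesgue_on {a<..<b})"
    by (intro integral_mono integrable_abs integrable_mult_indicator_lebesgue_on assms)
      (auto simp: indicator_def)
  finally show ?thesis .
qed

lemma primitive_diff:
  assumes "integrable (lebesgue_on {a<..<b}) f" "integrable (lebesgue_on {a<..<b}) g"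
  shows "primitive a b (\<lambda>t. f t - g t) x = primitive a b f x - primitive a b g x"
  unfolding primitive_def left_diff_distrib
  by (intro Bochner_Integration.integral_diff integrable_mult_indicator_lebesgue_on assms) auto

lemma primitive_eq_right:
  assumes "b \<le> x"
  shows "primitive a b f x = (\<integral>t. f t \<partial>lebesgue_on {a<..<b})"
  unfolding primitive_def using assms
  by (intro Bochner_Integration.integral_cong) (auto simp: indicator_def)

lemma primitive_eqI:
  assumes f: "integrable (lebesgue_on {a<..<b}) f" and "a \<le> x" "x \<le> b"
    and r: "(f has_integral r) {a..x}"
  shows "primitive a b f x = r"
proof -
  have "((\<lambda>t. if t \<in> {a..x} then f t else 0) has_integral r) {a..b}"
    using r assms(2,3) by (subst has_integral_restrict) auto
  then have "((\<lambda>t. f t * indicator {..x} t) has_integral r) {a..b}"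
    by (rule has_integral_eq[rotated]) auto
  then have "((\<lambda>t. f t * indicator {..x} t) has_integral r) {a<..<b}"
    by (simp add: has_integral_Icc_iff_Ioo)
  then show ?thesis
    unfolding primitive_def
    by (subst lebesgue_integral_eq_integral) (auto intro: integrable_mult_indicator_lebesgue_on f integral_unique)
qed

lemma test_function_boundary:
  assumes "test_function {a<..<b} \<phi>" "a < b"
  shows "\<phi> a = 0" "\<phi> b = 0"
proof -
  obtain c d where cd: "a < c" "c < d" "d < b" "\<And>x. x \<le> c \<or> d \<le> x \<Longrightarrow> \<phi> x = 0 \<and> deriv \<phi> x = 0"
    using test_function_support[OF assms] by metis
  show "\<phi> a = 0" "\<phi> b = 0" using cd(1-3) cd(4)[of a] cd(4)[of b] by auto
qed

lemma primitive_deriv_test_function: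
  assumes \<phi>: "test_function {a<..<b} \<phi>" and "a < b" "a \<le> x" "x \<le> b"
  shows "primitive a b (deriv \<phi>) x = \<phi> x"
proof (rule primitive_eqI)
  show "integrable (lebesgue_on {a<..<b}) (deriv \<phi>)"
    by (rule Lp_on_imp_integrable[OF test_function_Lp(2)[OF \<phi> \<open>a < b\<close>, of 1]]) auto
  have "\<phi> a = 0" by (rule test_function_boundary(1)[OF \<phi> \<open>a < b\<close>])
  moreover have "(deriv \<phi> has_integral (\<phi> x - \<phi> a)) {a..x}"
  proof (rule fundamental_theorem_of_calculus)
    show "(\<phi> has_vector_derivative deriv \<phi> z) (at z within {a..x})" for z
      using test_function_DERIV[OF \<phi>, of z]
      by (simp add: has_real_derivative_iff_has_vector_derivative has_vector_derivative_at_within)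
  qed (rule assms)
  ultimately show "(deriv \<phi> has_integral \<phi> x) {a..x}" by simp
qed (rule assms)+

text \<open>A test function is the primitive of its derivative, so its distance to the primitive of
  \<open>v\<close> is at most the L^1 distance of the derivatives, uniformly up to the end points.
  The approximating sequence thus tends to the primitive uniformly and to \<open>u\<close> in L^1.
  Its value 0 at \<open>b\<close> passes to the limit; here the Dirichlet condition enters.\<close>

lemma sobolev0_AE_eq_primitive:
  assumes u: "sobolev0 p {a<..<b} u v" and "1 \<le> p" "a < b"
  shows "AE x in lebesgue_on {a<..<b}. u x = primitive a b v x"
    and "(\<integral>x. v x \<partial>lebesgue_on {a<..<b}) = 0"
proof -
  let ?I = "{a<..<b}" let ?M = "lebesgue_on ?I"
  interpret finite_measure ?M by (rule finite_measure_lebesgue_on_Ioo)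
  obtain \<phi> where \<phi>: "\<And>n::nat. test_function ?I (\<phi> n)"
    and lim: "(\<lambda>n. (\<integral>x. \<bar>\<phi> n x - u x\<bar> powr p \<partial>?M) + (\<integral>x. \<bar>deriv (\<phi> n) x - v x\<bar> powr p \<partial>?M)) \<longlonglongrightarrow> 0"
    using u by (auto simp: sobolev0_def)
  have Lp: "Lp_on p ?I u" "Lp_on p ?I v" using u by (auto simp: sobolev0_def sobolev_def)
  have p0: "0 \<le> p" using \<open>1 \<le> p\<close> by simp
  have lm: "?I \<in> lmeasurable" by simp
  have Lp_n: "Lp_on p ?I (\<lambda>x. \<phi> n x - u x)" "Lp_on p ?I (\<lambda>x. deriv (\<phi> n) x - v x)" for n
    using Lp_on_add[OF test_function_Lp(1)[OF \<phi> \<open>a < b\<close> p0] Lp_on_cmult[OF Lp(1), of "-1"] p0, of n]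
      Lp_on_add[OF test_function_Lp(2)[OF \<phi> \<open>a < b\<close> p0] Lp_on_cmult[OF Lp(2), of "-1"] p0, of n]
    by simp_all
  have int: "integrable ?M u" "integrable ?M v"
    "integrable ?M (\<phi> n)" "integrable ?M (deriv (\<phi> n))" for n
    by (intro Lp_on_imp_integrable[OF _ \<open>1 \<le> p\<close> lm] Lp test_function_Lp[OF \<phi> \<open>a < b\<close> p0])+
  have "(\<lambda>n. \<integral>x. \<bar>\<phi> n x - u x\<bar> powr p \<partial>?M) \<longlonglongrightarrow> 0"
    by (rule tendsto_sandwich[OF _ _ tendsto_const lim]) auto
  then have lim1: "(\<lambda>n. \<integral>x. \<bar>\<phi> n x - u x\<bar> \<partial>?M) \<longlonglongrightarrow> 0"
    by (rule Lp_tendsto_imp_L1_tendsto[OF Lp_n(1) \<open>1 \<le> p\<close> lm])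
  have "(\<lambda>n. \<integral>x. \<bar>deriv (\<phi> n) x - v x\<bar> powr p \<partial>?M) \<longlonglongrightarrow> 0"
    by (rule tendsto_sandwich[OF _ _ tendsto_const lim]) auto
  then have lim2: "(\<lambda>n. \<integral>x. \<bar>deriv (\<phi> n) x - v x\<bar> \<partial>?M) \<longlonglongrightarrow> 0"
    by (rule Lp_tendsto_imp_L1_tendsto[OF Lp_n(2) \<open>1 \<le> p\<close> lm])
  let ?G = "primitive a b v"
  have dist: "\<bar>\<phi> n x - ?G x\<bar> \<le> (\<integral>x. \<bar>deriv (\<phi> n) x - v x\<bar> \<partial>?M)" if "a \<le> x" "x \<le> b" for n x
    using abs_primitive_le[of a b "\<lambda>x. deriv (\<phi> n) x - v x" x] int
    by (simp add: primitive_diff primitive_deriv_test_function[OF \<phi> \<open>a < b\<close> that])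
  have G_lim: "(\<lambda>n. \<phi> n x) \<longlonglongrightarrow> ?G x" if "a \<le> x" "x \<le> b" for x
  proof -
    have "(\<lambda>n. \<bar>\<phi> n x - ?G x\<bar>) \<longlonglongrightarrow> 0"
      by (rule tendsto_sandwich[OF _ _ tendsto_const lim2]) (auto simp: dist[OF that])
    then have "(\<lambda>n. \<phi> n x - ?G x) \<longlonglongrightarrow> 0" by (rule tendsto_rabs_zero_cancel)
    then show ?thesis by (rule LIM_zero_cancel)
  qed
  have "\<phi> n b = 0" for n by (rule test_function_boundary(2)[OF \<phi> \<open>a < b\<close>])
  then have "?G b = 0" using G_lim[of b] \<open>a < b\<close> by (simp add: LIMSEQ_const_iff)
  then show "(\<integral>x. v x \<partial>?M) = 0" by (simp add: primitive_eq_right)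
  have G_meas: "?G \<in> borel_measurable ?M"
    by (rule borel_measurable_LIMSEQ_real[of ?M "\<lambda>n. \<phi> n"])
      (use G_lim test_function_measurable[OF \<phi>] in auto)
  have G_int: "integrable ?M ?G"
    by (rule integrable_const_bound[OF _ G_meas]) (use abs_primitive_le[OF int(2)] in auto)
  have "(\<integral>x. \<bar>u x - ?G x\<bar> \<partial>?M) \<le> (\<integral>x. \<bar>\<phi> n x - u x\<bar> \<partial>?M) + measure ?M (space ?M) * (\<integral>x. \<bar>deriv (\<phi> n) x - v x\<bar> \<partial>?M)" for n
  proof -
    have "(\<integral>x. \<bar>u x - ?G x\<bar> \<partial>?M) \<le> (\<integral>x. \<bar>\<phi> n x - u x\<bar> + (\<integral>x. \<bar>deriv (\<phi> n) x - v x\<bar> \<partial>?M) \<partial>?M)"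
    proof (rule integral_mono)
      fix x assume "x \<in> space ?M"
      then have "a \<le> x" "x \<le> b" by auto
      from dist[OF this, of n]
      show "\<bar>u x - ?G x\<bar> \<le> \<bar>\<phi> n x - u x\<bar> + (\<integral>x. \<bar>deriv (\<phi> n) x - v x\<bar> \<partial>?M)" by linarith
    qed (use int G_int in auto)
    also have "\<dots> = (\<integral>x. \<bar>\<phi> n x - u x\<bar> \<partial>?M) + measure ?M (space ?M) * (\<integral>x. \<bar>deriv (\<phi> n) x - v x\<bar> \<partial>?M)"
      using int by simp
    finally show ?thesis .
  qed
  moreover have "(\<lambda>n. (\<integral>x. \<bar>\<phi> n x - u x\<bar> \<partial>?M) + measure ?M (space ?M) * (\<integral>x. \<bar>deriv (\<phi> n) x - v x\<bar> \<partial>?M)) \<longlonglongrightarrow> 0 + measure ?M (space ?M) * 0"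
    by (intro tendsto_add tendsto_mult tendsto_const lim1 lim2)
  ultimately have "(\<integral>x. \<bar>u x - ?G x\<bar> \<partial>?M) \<le> 0 + measure ?M (space ?M) * 0"
    by (intro LIMSEQ_le_const) auto
  moreover have "0 \<le> (\<integral>x. \<bar>u x - ?G x\<bar> \<partial>?M)" by simp
  ultimately have "(\<integral>x. \<bar>u x - ?G x\<bar> \<partial>?M) = 0" by linarith
  then have "AE x in ?M. \<bar>u x - ?G x\<bar> = 0"
    using int G_int by (subst (asm) integral_nonneg_eq_0_iff_AE) auto
  then show "AE x in ?M. u x = ?G x" by eventually_elim simp
qed

text \<open>The integral ignores the null set where \<open>v\<close> and \<open>V\<close> differ, so
  an identity almost everywhere becomes a derivative at every point. This is the passage from weak
  to classical derivatives.\<close>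

lemma primitive_DERIV:
  assumes v: "integrable (lebesgue_on {a<..<b}) v"
    and AE: "AE x in lebesgue_on {a<..<b}. v x = V x" and V: "continuous_on {a<..<b} V"
    and x: "x \<in> {a<..<b}"
  shows "(primitive a b v has_real_derivative V x) (at x)"
proof -
  let ?M = "lebesgue_on {a<..<b}"
  \<comment> \<open>\<open>V\<close> is continuous on the open interval only and may be unbounded
    near \<open>a\<close>, so its integral starts from an interior point.\<close>
  obtain c where c: "a < c" "c < x" using x dense[of a x] by auto
  obtain d where d: "x < d" "d < b" using x dense[of x b] by auto
  have contV: "continuous_on {c..y} V" if "y \<le> d" for y
    by (rule continuous_on_subset[OF V]) (use c d that in auto)
  have AE': "AE t in ?M. v t * indicator A t = V t * indicator A t" for A :: "real set"
    using AE by eventually_elim simp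
  have V_meas: "V \<in> borel_measurable ?M"
    by (rule continuous_imp_measurable_on_sets_lebesgue[OF V]) simp
  have eq: "primitive a b v y = primitive a b v c + integral {c..y} V" if y: "c \<le> y" "y \<le> d" for y
  proof -
    have "primitive a b v y - primitive a b v c = (\<integral>t. v t * indicator {..y} t - v t * indicator {..c} t \<partial>?M)"
      unfolding primitive_def
      by (intro Bochner_Integration.integral_diff[symmetric] integrable_mult_indicator_lebesgue_on v) auto
    also have "\<dots> = (\<integral>t. v t * indicator {c<..y} t \<partial>?M)"
      using y by (intro Bochner_Integration.integral_cong) (auto simp: indicator_def)
    also have "(\<integral>t. v t * indicator {c<..y} t \<partial>?M) = (\<integral>t. V t * indicator {c<..y} t \<partial>?M)"
      by (intro integral_cong_AE AE' borel_measurable_times indicator_measurable_lebesgue_on V_meas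
          borel_measurable_integrable[OF v]) simp_all
    also have "\<dots> = integral {a<..<b} (\<lambda>t. V t * indicator {c<..y} t)"
    proof (rule lebesgue_integral_eq_integral)
      have "integrable ?M (\<lambda>t. v t * indicator {c<..y} t) \<longleftrightarrow> integrable ?M (\<lambda>t. V t * indicator {c<..y} t)"
        by (intro integrable_cong_AE AE' borel_measurable_times indicator_measurable_lebesgue_on V_meas
          borel_measurable_integrable[OF v]) simp_all
      then show "integrable ?M (\<lambda>t. V t * indicator {c<..y} t)"
        using integrable_mult_indicator_lebesgue_on[OF v, of "{c<..y}"] by simp
    qed simp
    also have "\<dots> = integral {c..y} V"
    proof (rule integral_unique)
      have "(V has_integral integral {c..y} V) {c..y}"
        by (intro integrable_integral integrable_continuous_interval contV y)
      then have "((\<lambda>t. if t \<in> {c..y} then V t else 0) has_integral integral {c..y} V) {a<..<b}"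
        by (subst has_integral_restrict) (use c d y in auto)
      then show "((\<lambda>t. V t * indicator {c<..y} t) has_integral integral {c..y} V) {a<..<b}"
        by (rule has_integral_spike_finite[of "{c}", rotated 2]) (auto simp: indicator_def)
    qed
    finally show ?thesis by simp
  qed
  have "((\<lambda>y. integral {c..y} V) has_real_derivative V x) (at x within {c..d})"
    by (rule integral_has_real_derivative[OF contV]) (use c d in auto)
  then have "((\<lambda>y. integral {c..y} V) has_real_derivative V x) (at x)"
    using c d by (simp add: at_within_Icc_at)
  from DERIV_add[OF DERIV_const[of "primitive a b v c"] this]
  have "((\<lambda>y. primitive a b v c + integral {c..y} V) has_real_derivative V x) (at x)"
    by simp
  then show ?thesis
  proof (rule has_field_derivative_transform_within_open[of _ _ _ "{c<..<d}"])
    fix y assume "y \<in> {c<..<d}"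
    then show "primitive a b v c + integral {c..y} V = primitive a b v y"
      by (intro eq[symmetric]) auto
  qed (use c d in auto)
qed

lemma primitive_tendsto:
  assumes v: "integrable (lebesgue_on {a<..<b}) v" and "a < b"
  shows "(primitive a b v \<longlongrightarrow> 0) (at_right a)"
    and "(primitive a b v \<longlongrightarrow> (\<integral>x. v x \<partial>lebesgue_on {a<..<b})) (at_left b)"
proof -
  let ?M = "lebesgue_on {a<..<b}"
  \<comment> \<open>One argument for both ends: \<open>c\<close> is the limit of the indicators, 0
    at \<open>a\<close> and 1 at \<open>b\<close>.\<close>
  have dom: "(\<lambda>n. primitive a b v (S n)) \<longlonglongrightarrow> (\<integral>t. v t * c \<partial>?M)"
    if "\<And>t. a < t \<Longrightarrow> t < b \<Longrightarrow> (\<lambda>n. indicator {..S n} t) \<longlonglongrightarrow> c" for S :: "nat \<Rightarrow> real" and c :: real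
    unfolding primitive_def
  proof (rule integral_dominated_convergence[where w = "\<lambda>t. \<bar>v t\<bar>"])
    show "AE t in ?M. (\<lambda>n. v t * indicator {..S n} t) \<longlonglongrightarrow> v t * c"
      by (intro AE_I2 tendsto_mult tendsto_const that) auto
    show "AE t in ?M. norm (v t * indicator {..S n} t) \<le> \<bar>v t\<bar>" for n
      by (intro AE_I2) (auto simp: indicator_def)
    show "(\<lambda>t. v t * indicator {..S n} t) \<in> borel_measurable ?M" for n
      by (intro borel_measurable_integrable integrable_mult_indicator_lebesgue_on v) auto
  qed (use v in auto)
  show "(primitive a b v \<longlongrightarrow> 0) (at_right a)"
  proof (rule tendsto_at_right_sequentially[OF \<open>a < b\<close>])
    fix S :: "nat \<Rightarrow> real" assume S: "S \<longlonglongrightarrow> a"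
    have "(\<lambda>n. primitive a b v (S n)) \<longlonglongrightarrow> (\<integral>t. v t * 0 \<partial>?M)"
    proof (rule dom)
      fix t assume "a < t"
      from order_tendstoD(2)[OF S this] have "eventually (\<lambda>n. indicator {..S n} t = (0 :: real)) sequentially"
        by eventually_elim simp
      then show "(\<lambda>n. indicator {..S n} t) \<longlonglongrightarrow> (0 :: real)"
        by (rule tendsto_eventually)
    qed
    then show "(\<lambda>n. primitive a b v (S n)) \<longlonglongrightarrow> 0" by simp
  qed
  show "(primitive a b v \<longlongrightarrow> (\<integral>x. v x \<partial>?M)) (at_left b)"
  proof (rule tendsto_at_left_sequentially[OF \<open>a < b\<close>])
    fix S :: "nat \<Rightarrow> real" assume S: "S \<longlonglongrightarrow> b"
    have "(\<lambda>n. primitive a b v (S n)) \<longlonglongrightarrow> (\<integral>t. v t * 1 \<partial>?M)"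
    proof (rule dom)
      fix t assume "t < b"
      from order_tendstoD(1)[OF S this] have "eventually (\<lambda>n. indicator {..S n} t = (1 :: real)) sequentially"
        by eventually_elim simp
      then show "(\<lambda>n. indicator {..S n} t) \<longlonglongrightarrow> (1 :: real)"
        by (rule tendsto_eventually)
    qed
    then show "(\<lambda>n. primitive a b v (S n)) \<longlonglongrightarrow> (\<integral>x. v x \<partial>?M)" by simp
  qed
qed

section \<open>Regularity of the first eigenfunction\<close>

lemma continuous_on_signed_powr:
  assumes "continuous_on S f" "0 < r"
  shows "continuous_on S (\<lambda>x. signed_powr r (f x))"
proof -
  \<comment> \<open>Splitting into positive and negative parts removes \<open>sgn\<close>, which is
    discontinuous at 0.\<close>
  have "signed_powr r s = max s 0 powr r - max (- s) 0 powr r" for s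
    by (auto simp: signed_powr_def sgn_real_def max_def)
  moreover have "continuous_on S (\<lambda>x. max (f x) 0 powr r - max (- f x) 0 powr r)"
    using assms by (intro continuous_intros continuous_on_powr') auto
  ultimately show ?thesis by simp
qed

lemma signed_powr_inverse:
  assumes "0 < r"
  shows "signed_powr r (signed_powr (1 / r) s) = s" "signed_powr (1 / r) (signed_powr r s) = s"
  using assms by (auto simp: signed_powr_def sgn_real_def abs_mult powr_powr)

text \<open>The set where the functions differ is open, and a nonempty open set is not null.\<close>

lemma continuous_AE_eq_imp_eq:
  fixes f g :: "real \<Rightarrow> real"
  assumes AE: "AE x in lebesgue_on {a<..<b}. f x = g x"
    and cont: "continuous_on {a<..<b} f" "continuous_on {a<..<b} g"
    and x: "x \<in> {a<..<b}"
  shows "f x = g x"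
proof (rule ccontr)
  assume ne: "f x \<noteq> g x"
  define S where "S = {y \<in> {a<..<b}. f y - g y \<in> - {0}}"
  have "continuous_on {a<..<b} (\<lambda>y. f y - g y)"
    using cont by (intro continuous_intros)
  then have "open ((\<lambda>y. f y - g y) -` (- {0}) \<inter> {a<..<b})"
    by (subst (asm) continuous_on_open_vimage) (simp, meson open_Compl closed_singleton)
  moreover have "(\<lambda>y. f y - g y) -` (- {0}) \<inter> {a<..<b} = S" by (auto simp: S_def)
  ultimately have "open S" by simp
  moreover have "S \<noteq> {}" using x ne by (auto simp: S_def)
  ultimately have "\<not> negligible S" by (rule open_not_negligible)
  moreover have "AE y in lebesgue. y \<in> {a<..<b} \<longrightarrow> f y = g y"
    using AE by (subst (asm) AE_restrict_space_iff) auto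
  then have "AE y in lebesgue. y \<notin> S"
    by eventually_elim (auto simp: S_def)
  then have "S \<in> null_sets lebesgue"
    using \<open>open S\<close> by (subst AE_iff_null_sets) auto
  ultimately show False by (simp add: negligible_iff_null_sets)
qed

lemma not_AE_False_lebesgue_on_Ioo:
  assumes "a < b"
  shows "\<not> (AE x in lebesgue_on {a<..<b::real}. False)"
proof
  assume "AE x in lebesgue_on {a<..<b}. False"
  then have "AE x in lebesgue_on {a<..<b}. (0::real) = 1" by simp
  from continuous_AE_eq_imp_eq[OF this] dense[OF assms] show False by auto
qed

text \<open>With \<open>K\<close> a primitive of u^(p-1), the weak equation says that flux + lam K
  is weakly constant, so the flux of \<open>v\<close> agrees almost everywhere with a differentiable
  function \<open>W\<close>. Undoing the signed power makes \<open>v\<close> continuous up to a null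
  set, and hence \<open>u\<close>, being its primitive, continuously differentiable.\<close>

lemma first_eigenfunction_ODE:
  assumes "1 < p" "a < b" and u: "first_eigenfunction p {a<..<b} u"
  obtains lam V W where "0 < lam"
    "\<And>x. x \<in> {a<..<b} \<Longrightarrow> (u has_real_derivative V x) (at x)"
    "\<And>x. x \<in> {a<..<b} \<Longrightarrow> signed_powr (p - 1) (V x) = W x"
    "\<And>x. x \<in> {a<..<b} \<Longrightarrow> (W has_real_derivative - lam * u x powr (p - 1)) (at x)"
    "(u \<longlongrightarrow> 0) (at_right a)" "(u \<longlongrightarrow> 0) (at_left b)"
proof -
  let ?I = "{a<..<b}" let ?M = "lebesgue_on ?I"
  interpret finite_measure ?M by (rule finite_measure_lebesgue_on_Ioo)
  define lam where "lam = first_eigenvalue p ?I"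
  obtain v where cont: "continuous_on ?I u" and pos: "\<And>x. x \<in> ?I \<Longrightarrow> 0 < u x"
    and sob: "sobolev0 p ?I u v" and ray: "rayleigh p ?I u v = lam"
    using u by (auto simp: first_eigenfunction_def lam_def)
  have Lp: "Lp_on p ?I u" "Lp_on p ?I v" using sob by (auto simp: sobolev0_def sobolev_def)
  have p1: "1 \<le> p" using \<open>1 < p\<close> by simp
  have int_v: "integrable ?M v" by (rule Lp_on_imp_integrable[OF Lp(2) p1]) simp
  have int_p: "integrable ?M (\<lambda>x. \<bar>u x\<bar> powr p)" "integrable ?M (\<lambda>x. \<bar>v x\<bar> powr p)"
    using Lp by (auto simp: Lp_on_def)
  have int_s: "integrable ?M (\<lambda>x. signed_powr (p - 1) (f x))" if "Lp_on p ?I f" for f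
  proof (rule Bochner_Integration.integrable_bound)
    have "Lp_on (p - 1) ?I f" by (rule Lp_on_mono[OF that]) (use \<open>1 < p\<close> in auto)
    then show "integrable ?M (\<lambda>x. \<bar>f x\<bar> powr (p - 1))" by (simp add: Lp_on_def)
    have "f \<in> borel_measurable ?M" using that by (simp add: Lp_on_def)
    then show "(\<lambda>x. signed_powr (p - 1) (f x)) \<in> borel_measurable ?M" by simp
  qed (simp add: abs_signed_powr)

  have u_ne: "(\<integral>x. \<bar>u x\<bar> powr p \<partial>?M) \<noteq> 0"
  proof
    assume "(\<integral>x. \<bar>u x\<bar> powr p \<partial>?M) = 0"
    then have "AE x in ?M. \<bar>u x\<bar> powr p = 0"
      using int_p by (subst (asm) integral_nonneg_eq_0_iff_AE) auto
    moreover have "AE x in ?M. 0 < u x" using pos by (intro AE_I2) simp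
    ultimately have "AE x in ?M. False" by eventually_elim simp
    then show False using not_AE_False_lebesgue_on_Ioo[OF \<open>a < b\<close>] by blast
  qed
  have min: "(\<integral>x. \<bar>v x\<bar> powr p \<partial>?M) = first_eigenvalue p ?I * (\<integral>x. \<bar>u x\<bar> powr p \<partial>?M)"
    using ray u_ne by (simp add: rayleigh_def lam_def field_simps)
  note EL = euler_lagrange[OF sob \<open>1 < p\<close> \<open>a < b\<close> min, folded lam_def]
  define G where "G = primitive a b v"
  have uG: "AE x in ?M. u x = G x" and v0: "(\<integral>x. v x \<partial>?M) = 0"
    using sobolev0_AE_eq_primitive[OF sob p1 \<open>a < b\<close>] by (simp_all add: G_def)
  have "0 \<le> lam" unfolding ray[symmetric] rayleigh_def by simp
  \<comment> \<open>A zero eigenvalue would force \<open>v\<close> to vanish almost everywhere, and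
    \<open>u\<close> along with its primitive.\<close>
  moreover have "lam \<noteq> 0"
  proof
    assume "lam = 0"
    then have "(\<integral>x. \<bar>v x\<bar> powr p \<partial>?M) = 0" using min by (simp add: lam_def)
    then have "AE x in ?M. \<bar>v x\<bar> powr p = 0"
      using int_p by (subst (asm) integral_nonneg_eq_0_iff_AE) auto
    then have "AE x in ?M. v x * indicator {..y} x = 0" for y
      by eventually_elim simp
    then have "G y = 0" for y unfolding G_def primitive_def by (rule integral_eq_zero_AE)
    with uG have "AE x in ?M. u x = 0" by simp
    then have "(\<integral>x. \<bar>u x\<bar> powr p \<partial>?M) = 0"
      by (intro integral_eq_zero_AE) auto
    with u_ne show False ..
  qed
  ultimately have lam: "0 < lam" by simp

  define f where "f x = signed_powr (p - 1) (u x)" for x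
  have f: "f x = u x powr (p - 1)" if "x \<in> ?I" for x
    using pos[OF that] by (simp add: f_def signed_powr_def)
  define K where "K = primitive a b f"
  have int_f: "integrable ?M f" unfolding f_def by (rule int_s[OF Lp(1)])
  have cont_f: "continuous_on ?I f"
    unfolding f_def using cont \<open>1 < p\<close> by (intro continuous_on_signed_powr) auto
  have K: "(K has_real_derivative f x) (at x)" if "x \<in> ?I" for x
    unfolding K_def by (rule primitive_DERIV[OF int_f _ cont_f that]) simp
  have cont_K: "continuous_on ?I K"
    using K by (intro continuous_at_imp_continuous_on ballI) (rule DERIV_isCont)
  have int_K: "integrable ?M K"
  proof (rule integrable_const_bound)
    show "AE x in ?M. norm (K x) \<le> (\<integral>t. \<bar>f t\<bar> \<partial>?M)"
      using abs_primitive_le[OF int_f] by (simp add: K_def)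
    show "K \<in> borel_measurable ?M"
      by (rule continuous_imp_measurable_on_sets_lebesgue[OF cont_K]) simp
  qed
  obtain k where k: "AE x in ?M. signed_powr (p - 1) (v x) + lam * K x = k"
  proof (rule du_bois_reymond[OF \<open>a < b\<close>])
    have iv: "integrable ?M (\<lambda>x. signed_powr (p - 1) (v x))" by (rule int_s[OF Lp(2)])
    show "integrable ?M (\<lambda>x. signed_powr (p - 1) (v x) + lam * K x)"
      using iv int_K by simp
    fix \<phi> assume \<phi>: "test_function ?I \<phi>"
    note i = integrable_mult_test_function[OF \<phi> \<open>a < b\<close>]
    have "(\<integral>x. (signed_powr (p - 1) (v x) + lam * K x) * deriv \<phi> x \<partial>?M)
      = (\<integral>x. signed_powr (p - 1) (v x) * deriv \<phi> x + lam * (K x * deriv \<phi> x) \<partial>?M)"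
      by (simp add: distrib_right mult.assoc)
    also have "\<dots> = (\<integral>x. signed_powr (p - 1) (v x) * deriv \<phi> x \<partial>?M) + lam * (\<integral>x. K x * deriv \<phi> x \<partial>?M)"
      using i(2)[OF iv] i(2)[OF int_K] by simp
    also have "\<dots> = 0"
    proof -
      have "(\<integral>x. K x * deriv \<phi> x \<partial>?M) = - (\<integral>x. f x * \<phi> x \<partial>?M)"
        by (rule lebesgue_by_parts[OF \<phi> \<open>a < b\<close> K int_K int_f])
      then show ?thesis unfolding EL[OF \<phi>] f_def by simp
    qed
    finally show "(\<integral>x. (signed_powr (p - 1) (v x) + lam * K x) * deriv \<phi> x \<partial>?M) = 0" .
  qed
  define W where "W x = k - lam * K x" for x
  define V where "V x = signed_powr (1 / (p - 1)) (W x)" for x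
  have VW: "signed_powr (p - 1) (V x) = W x" for x
    unfolding V_def using \<open>1 < p\<close> by (intro signed_powr_inverse) simp
  have vV: "AE x in ?M. v x = V x"
    using k
  proof eventually_elim
    case (elim x)
    then have "W x = signed_powr (p - 1) (v x)" by (simp add: W_def)
    then show ?case unfolding V_def using signed_powr_inverse(2)[of "p - 1" "v x"] \<open>1 < p\<close> by simp
  qed
  have cont_V: "continuous_on ?I V"
    unfolding V_def W_def using cont_K \<open>1 < p\<close>
    by (intro continuous_on_signed_powr continuous_intros) auto
  have G: "(G has_real_derivative V x) (at x)" if "x \<in> ?I" for x
    unfolding G_def by (rule primitive_DERIV[OF int_v vV cont_V that])
  have "continuous_on ?I G"
    using G by (intro continuous_at_imp_continuous_on ballI) (rule DERIV_isCont)
  \<comment> \<open>Equality almost everywhere becomes equality everywhere, because a first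
    eigenfunction is taken to be the continuous representative.\<close>
  then have eq: "u x = G x" if "x \<in> ?I" for x
    by (rule continuous_AE_eq_imp_eq[OF uG cont _ that])
  show ?thesis
  proof (rule that[OF lam _ VW])
    show "(u has_real_derivative V x) (at x)" if "x \<in> ?I" for x
      by (rule has_field_derivative_transform_within_open[OF G[OF that], of ?I])
        (use that eq in auto)
    show "(W has_real_derivative - lam * u x powr (p - 1)) (at x)" if "x \<in> ?I" for x
      using DERIV_diff[OF DERIV_const DERIV_cmult[OF K[OF that]], of k lam] f[OF that]
      by (simp add: W_def[abs_def])
    have "eventually (\<lambda>x. G x = u x) (at_right a)"
      using eventually_at_right_real[OF \<open>a < b\<close>] by eventually_elim (simp add: eq)
    moreover have "(G \<longlongrightarrow> 0) (at_right a)"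
      unfolding G_def by (rule primitive_tendsto(1)[OF int_v \<open>a < b\<close>])
    ultimately show "(u \<longlongrightarrow> 0) (at_right a)" by (rule Lim_transform_eventually[rotated])
    have "eventually (\<lambda>x. G x = u x) (at_left b)"
      using eventually_at_left_real[OF \<open>a < b\<close>] by eventually_elim (simp add: eq)
    moreover have "(G \<longlongrightarrow> 0) (at_left b)"
      unfolding G_def using primitive_tendsto(2)[OF int_v \<open>a < b\<close>] v0 by simp
    ultimately show "(u \<longlongrightarrow> 0) (at_left b)" by (rule Lim_transform_eventually[rotated])
  qed
qed

section \<open>The Riccati equation\<close>

text \<open>
  The primitive \<open>A\<close> of \<open>1 / F\<close> is odd and \<open>A (X x) = c - x\<close>. As \<open>X\<close> is onto, it takes the value
  \<open>- X x\<close>, necessarily at \<open>2 * c - x\<close>; so the interval is symmetric about \<open>c\<close> and \<open>c = 0\<close>.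
\<close>

lemma odd_solution_of_even_autonomous_ODE:
  fixes X F :: "real \<Rightarrow> real"
  assumes "0 < R"
    and F: "continuous_on UNIV F" "\<And>s. 0 < F s" "\<And>s. F (- s) = F s"
    and X: "\<And>x. x \<in> {-R<..<R} \<Longrightarrow> (X has_real_derivative - F (X x)) (at x)"
    and unbdd: "\<And>B. \<exists>x\<in>{-R<..<R}. X x < B" "\<And>B. \<exists>x\<in>{-R<..<R}. B < X x"
    and x: "x \<in> {-R<..<R}"
  shows "X (- x) = - X x"
proof -
  have surj: "\<exists>x\<in>{-R<..<R}. X x = s" for s
  proof -
    have "continuous_on {-R<..<R} X"
      using X by (intro continuous_at_imp_continuous_on ballI) (rule DERIV_isCont)
    then have conn: "connected (X ` {-R<..<R})"
      by (rule connected_continuous_image) (rule connected_Ioo)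
    obtain x1 where x1: "x1 \<in> {-R<..<R}" "X x1 < s" using unbdd(1)[of s] by (rule bexE)
    obtain x2 where x2: "x2 \<in> {-R<..<R}" "s < X x2" using unbdd(2)[of s] by (rule bexE)
    have "s \<in> X ` {-R<..<R}"
      by (rule connectedD_interval[OF conn imageI[OF x1(1)] imageI[OF x2(1)]]) (use x1 x2 in simp_all)
    then show ?thesis by auto
  qed
  have "\<exists>A. \<forall>x::real. -\<infinity> < ereal x \<longrightarrow> ereal x < \<infinity> \<longrightarrow> (A has_vector_derivative 1 / F x) (at x)"
  proof (rule einterval_antiderivative)
    show "isCont (\<lambda>x. 1 / F x) x" for x
      using F(1) F(2)[of x] by (intro continuous_intros) (auto simp: continuous_on_eq_continuous_at)
  qed simp
  then obtain A0 where A0: "\<And>s. (A0 has_real_derivative 1 / F s) (at s)"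
    by (auto simp: has_real_derivative_iff_has_vector_derivative)
  \<comment> \<open>Normalizing by \<open>A 0 = 0\<close> is what makes the primitive of an even
    function odd.\<close>
  define A where "A s = A0 s - A0 0" for s
  have A: "(A has_real_derivative 1 / F s) (at s)" for s
    unfolding A_def[abs_def] using DERIV_diff[OF A0 DERIV_const[of "A0 0"]] by simp
  have A_odd: "A (- s) = - A s" for s
  proof -
    have "((\<lambda>s. A s + A (- s)) has_real_derivative 1 / F s + 1 / F (- s) * (- 1)) (at s)" for s
      by (intro DERIV_add A DERIV_chain2[where f = A]) (auto intro!: derivative_eq_intros)
    then have "((\<lambda>s. A s + A (- s)) has_real_derivative 0) (at s)" for s
      by (simp add: F(3))
    then have "A s + A (- s) = A 0 + A (- 0)"
      using DERIV_isconst_all[of "\<lambda>s. A s + A (- s)"] by blast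
    then show ?thesis by (simp add: A_def)
  qed
  have A_mono: "A s < A t" if "s < t" for s t
  proof (rule DERIV_pos_imp_increasing[OF that])
    show "\<exists>y. (A has_real_derivative y) (at z) \<and> 0 < y" for z
      using A[of z] F(2)[of z] by (intro exI[of _ "1 / F z"]) simp
  qed
  define c where "c = A (X 0)"
  have AX: "A (X x) = c - x" if x: "x \<in> {-R<..<R}" for x
  proof -
    have "((\<lambda>x. A (X x) + x) has_real_derivative 0) (at x within {-R<..<R})" if "x \<in> {-R<..<R}" for x
    proof -
      have "((\<lambda>x. A (X x) + x) has_real_derivative 1 / F (X x) * (- F (X x)) + 1) (at x)"
        by (intro DERIV_add DERIV_chain2[OF A X] that DERIV_ident)
      then show ?thesis using F(2)[of "X x"] by (simp add: has_field_derivative_at_within)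
    qed
    then obtain k where k: "\<And>x. x \<in> {-R<..<R} \<Longrightarrow> A (X x) + x = k"
      using has_field_derivative_zero_constant[of "{-R<..<R}" "\<lambda>x. A (X x) + x"] by auto
    show ?thesis using k[OF x] k[of 0] \<open>0 < R\<close> unfolding c_def by simp
  qed
  have refl: "2 * c - x \<in> {-R<..<R} \<and> X (2 * c - x) = - X x" if x: "x \<in> {-R<..<R}" for x
  proof -
    obtain y where y: "y \<in> {-R<..<R}" "X y = - X x" using surj by blast
    have "A (X y) = - A (X x)" unfolding y(2) by (rule A_odd)
    then have "y = 2 * c - x" using AX[OF x] AX[OF y(1)] by simp
    then show ?thesis using y by simp
  qed
  have "c = 0"
  proof (rule ccontr)
    assume "c \<noteq> 0"
    have "0 \<in> {-R<..<R}" using \<open>0 < R\<close> by simp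
    from refl[OF this] have "\<bar>2 * c\<bar> < R" by auto
    \<comment> \<open>For c > 0 this is the point c - R, whose reflection R + c lies outside the
      interval; c < 0 is the mirror image. The bound \<open>\<bar>2 * c\<bar> < R\<close> keeps the
      point itself inside.\<close>
    then have "- sgn c * (R - \<bar>c\<bar>) \<in> {-R<..<R}" using \<open>c \<noteq> 0\<close>
      by (auto simp: sgn_real_def)
    from refl[OF this] show False using \<open>c \<noteq> 0\<close> \<open>0 < R\<close> by (auto simp: sgn_real_def split: if_splits)
  qed
  then show ?thesis using refl[OF x] by simp
qed

lemma odd_autonomous_modulus:
  fixes T F :: "real \<Rightarrow> real"
  assumes T: "\<And>x. x \<in> {-R<..<R} \<Longrightarrow> (T has_real_derivative F (T x)) (at x)"
    and odd: "\<And>x. x \<in> {-R<..<R} \<Longrightarrow> T (- x) = - T x"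
    and F: "\<And>s. 0 < F s" "\<And>s t. \<bar>s\<bar> < \<bar>t\<bar> \<Longrightarrow> F s < F t"
    and xy: "x \<in> {-R<..<R}" "y \<in> {-R<..<R}" "x < y"
  shows "2 * T ((y - x) / 2) \<le> T y - T x"
    and "2 * T ((y - x) / 2) = T y - T x \<longleftrightarrow> x = - y"
proof -
  have mono: "T s < T t" if "s \<in> {-R<..<R}" "t \<in> {-R<..<R}" "s < t" for s t
  proof (rule DERIV_pos_imp_increasing[OF that(3)])
    fix z assume "s \<le> z" "z \<le> t"
    then have "z \<in> {-R<..<R}" using that by auto
    from T[OF this] F(1) show "\<exists>y. (T has_real_derivative y) (at z) \<and> 0 < y" by blast
  qed
  define d where "d = (y - x) / 2"
  define m where "m = \<bar>(x + y) / 2\<bar>"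
  \<comment> \<open>\<open>d + m\<close> is the larger of \<open>y\<close> and \<open>- x\<close>,
    hence below \<open>R\<close>. The absolute value in \<open>m\<close> makes use of the
    evenness.\<close>
  have dm: "0 < d" "0 \<le> m" "d + m < R" using xy by (auto simp: d_def m_def abs_if field_simps)
  have "\<bar>T s\<bar> < \<bar>T t\<bar>" if "\<bar>s\<bar> < t" "t < R" for s t
  proof -
    have "T s < T t" by (rule mono) (use that in auto)
    moreover have "T (- t) < T s" by (rule mono) (use that in auto)
    moreover have "T (- t) = - T t" using that by (intro odd) auto
    ultimately show ?thesis by linarith
  qed
  note abs_less = this
  have strict: "2 * T d < T (d + m) + T (d - m)" if "0 < m"
  proof -
    have "T (d + 0) + T (d - 0) < T (d + m) + T (d - m)"
    \<comment> \<open>At \<open>z = 0\<close> the two terms of the derivative cancel, so it is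
      positive only on the open interval. There it is, because
      \<open>\<bar>d - z\<bar> < d + z\<close> for positive \<open>d\<close> and
      \<open>z\<close>.\<close>
    proof (rule DERIV_pos_imp_increasing_open[OF that])
      fix z assume z: "0 < z" "z < m"
      have "((\<lambda>z. T (d + z) + T (d - z)) has_real_derivative F (T (d + z)) * 1 + F (T (d - z)) * (- 1)) (at z)"
      proof (rule DERIV_add)
        have "((\<lambda>z. d + z) has_real_derivative 1) (at z)" "((\<lambda>z. d - z) has_real_derivative - 1) (at z)"
          by (auto intro!: derivative_eq_intros)
        moreover have "d + z \<in> {-R<..<R}" "d - z \<in> {-R<..<R}" using z dm by auto
        ultimately show "((\<lambda>z. T (d + z)) has_real_derivative F (T (d + z)) * 1) (at z)"
          "((\<lambda>z. T (d - z)) has_real_derivative F (T (d - z)) * (- 1)) (at z)"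
          by (blast intro: DERIV_chain2[OF T])+
      qed
      moreover have "F (T (d - z)) < F (T (d + z))"
        by (rule F(2), rule abs_less) (use z dm in auto)
      then have "0 < F (T (d + z)) * 1 + F (T (d - z)) * (- 1)" by simp
      ultimately show "\<exists>y. ((\<lambda>z. T (d + z) + T (d - z)) has_real_derivative y) (at z) \<and> 0 < y"
        by blast
    next
      have cont: "continuous_on {-R<..<R} T"
        using T by (intro continuous_at_imp_continuous_on ballI) (rule DERIV_isCont)
      show "continuous_on {0..m} (\<lambda>z. T (d + z) + T (d - z))"
      proof (rule continuous_on_add)
        show "continuous_on {0..m} (\<lambda>z. T (d + z))"
          by (rule continuous_on_compose2[OF cont]) (use dm in \<open>auto intro!: continuous_intros\<close>)
        show "continuous_on {0..m} (\<lambda>z. T (d - z))"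
          by (rule continuous_on_compose2[OF cont]) (use dm in \<open>auto intro!: continuous_intros\<close>)
      qed
    qed
    then show ?thesis by simp
  qed
  have eq: "T y - T x = T (d + m) + T (d - m)"
  proof (cases "0 \<le> x + y")
    case True
    then have "d + m = y" "d - m = - x" by (auto simp: d_def m_def field_simps)
    then show ?thesis using odd[OF xy(1)] by simp
  next
    case False
    then have "d + m = - x" "d - m = y" by (auto simp: d_def m_def field_simps)
    then show ?thesis using odd[OF xy(1)] by simp
  qed
  have "m = 0 \<longleftrightarrow> x = - y" by (auto simp: m_def)
  moreover have "2 * T d \<le> T y - T x \<and> (2 * T d = T y - T x \<longleftrightarrow> m = 0)"
    using strict dm(2) unfolding eq by (cases "m = 0") auto
  ultimately show "2 * T ((y - x) / 2) \<le> T y - T x"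
    and "2 * T ((y - x) / 2) = T y - T x \<longleftrightarrow> x = - y"
    by (auto simp: d_def)
qed

text \<open>Gronwall: \<open>u x * exp (C * x)\<close> is nondecreasing, which keeps
  \<open>u\<close> above the positive constant \<open>u 0 * exp (- C * R)\<close>.\<close>

lemma log_deriv_bound_imp_not_tendsto_0:
  fixes u V :: "real \<Rightarrow> real"
  assumes "0 < R" "0 < u 0" "0 \<le> C"
    and u: "\<And>x. 0 \<le> x \<Longrightarrow> x < R \<Longrightarrow> (u has_real_derivative V x) (at x)"
    and V: "\<And>x. 0 \<le> x \<Longrightarrow> x < R \<Longrightarrow> - C * u x \<le> V x"
  shows "\<not> (u \<longlongrightarrow> 0) (at_left R)"
proof
  assume lim: "(u \<longlongrightarrow> 0) (at_left R)"
  have ge: "u 0 * exp (- C * R) \<le> u x" if x: "0 \<le> x" "x < R" for x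
  proof -
    have "u 0 * exp (C * 0) \<le> u x * exp (C * x)"
    proof (rule DERIV_nonneg_imp_nondecreasing[OF x(1)])
      fix z assume z: "0 \<le> z" "z \<le> x"
      have "((\<lambda>z. u z * exp (C * z)) has_real_derivative V z * exp (C * z) + exp (C * z) * C * u z) (at z)"
        by (rule DERIV_mult[OF u]) (use z x in \<open>auto intro!: derivative_eq_intros\<close>)
      moreover have "V z * exp (C * z) + exp (C * z) * C * u z = exp (C * z) * (V z - - C * u z)"
        by (simp add: algebra_simps)
      moreover have "0 \<le> V z - - C * u z" using V[of z] z x by simp
      ultimately show "\<exists>y. ((\<lambda>z. u z * exp (C * z)) has_real_derivative y) (at z) \<and> 0 \<le> y"
        by (metis exp_ge_zero mult_nonneg_nonneg)
    qed
    then have "u 0 * exp (- C * x) \<le> u x"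
      by (simp add: exp_minus field_simps)
    moreover have "u 0 * exp (- C * R) \<le> u 0 * exp (- C * x)"
      using \<open>0 < u 0\<close> \<open>0 \<le> C\<close> x by (simp add: mult_left_mono)
    ultimately show ?thesis by linarith
  qed
  have "eventually (\<lambda>x. u x < u 0 * exp (- C * R)) (at_left R)"
    using \<open>0 < u 0\<close> by (intro order_tendstoD(2)[OF lim]) simp
  moreover have "eventually (\<lambda>x. x \<in> {0<..<R}) (at_left R)"
    by (rule eventually_at_left_real[OF \<open>0 < R\<close>])
  ultimately have "eventually (\<lambda>x. False) (at_left R)"
  proof eventually_elim
    case (elim x)
    then show ?case using ge[of x] by simp
  qed
  then show False by simp
qed

lemma signed_powr_bound_imp_ge:
  assumes "0 < r" "- B \<le> signed_powr r s" "0 \<le> B"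
  shows "- (B powr (1 / r)) \<le> s"
proof (cases "s < 0")
  case True
  then have "(- s) powr r \<le> B" using assms(2) by (simp add: signed_powr_def)
  then have "((- s) powr r) powr (1 / r) \<le> B powr (1 / r)"
    using assms(1) by (intro powr_mono2) auto
  then show ?thesis using True assms(1) by (simp add: powr_powr)
next
  case False
  then show ?thesis using powr_ge_zero[of B "1 / r"] by linarith
qed

section \<open>Algebra of signed powers and derivation of the Riccati equation\<close>

lemma signed_powr_nonneg: "0 \<le> s \<Longrightarrow> 0 \<le> signed_powr r s"
  by (simp add: signed_powr_def)

lemma signed_powr_uminus: "signed_powr r (- s) = - signed_powr r s"
  by (simp add: signed_powr_def)

lemma signed_powr_mult_self: "signed_powr (p - 1) s * s = \<bar>s\<bar> powr p"
proof (cases "s = 0")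
  case False
  then have "\<bar>s\<bar> powr p = \<bar>s\<bar> powr (p - 1) * \<bar>s\<bar>"
    by (simp add: powr_diff)
  then show ?thesis by (simp add: signed_powr_def sgn_real_def)
qed (simp add: signed_powr_def)

lemma signed_powr_divide:
  "0 < c \<Longrightarrow> signed_powr r (s / c) = signed_powr r s / c powr r"
  by (simp add: signed_powr_def sgn_divide abs_divide powr_divide)

text \<open>The quotient rule gives - lam - (p - 1) W V / u^p. The exponent p / (p - 1) is conjugate
  to p and turns \<bar>V / u\<bar>^(p-1) into \<bar>V / u\<bar>^p, which is W V / u^p; so the
  right-hand side depends on the quotient alone.\<close>

lemma riccati_DERIV:
  assumes "1 < p" "0 < u x"
    and u: "(u has_real_derivative V x) (at x)"
    and W: "(W has_real_derivative - lam * u x powr (p - 1)) (at x)"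
    and VW: "signed_powr (p - 1) (V x) = W x"
  shows "((\<lambda>x. W x / u x powr (p - 1)) has_real_derivative
    - (lam + (p - 1) * \<bar>W x / u x powr (p - 1)\<bar> powr (p / (p - 1)))) (at x)"
proof -
  define U where "U = u x powr (p - 1)"
  have U: "0 < U" using assms by (simp add: U_def)
  have "((\<lambda>x. u x powr (p - 1)) has_real_derivative (p - 1) * u x powr (p - 1 - 1) * V x) (at x)"
    using u \<open>0 < u x\<close> by (auto intro!: derivative_eq_intros)
  from DERIV_divide[OF W this]
  have D: "((\<lambda>x. W x / u x powr (p - 1)) has_real_derivative
      (- lam * U * U - W x * ((p - 1) * u x powr (p - 1 - 1) * V x)) / (U * U)) (at x)"
    using U by (simp add: U_def)
  have "W x / U = signed_powr (p - 1) (V x / u x)"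
    using \<open>0 < u x\<close> by (simp add: U_def VW[symmetric] signed_powr_divide)
  then have "\<bar>W x / U\<bar> powr (p / (p - 1)) = (\<bar>V x / u x\<bar> powr (p - 1)) powr (p / (p - 1))"
    by (simp only: abs_signed_powr)
  also have "\<dots> = \<bar>V x / u x\<bar> powr p" using \<open>1 < p\<close> by (simp add: powr_powr)
  also have "\<dots> = W x * V x / u x powr p"
    using \<open>0 < u x\<close> signed_powr_mult_self[of p "V x"] by (simp add: VW abs_divide powr_divide)
  finally have abs: "\<bar>W x / U\<bar> powr (p / (p - 1)) = W x * V x / u x powr p" .
  have UU: "U * U = u x powr (p - 1 - 1) * u x powr p"
    unfolding U_def powr_add[symmetric] by (simp add: algebra_simps)
  have "(- lam * U * U - W x * ((p - 1) * u x powr (p - 1 - 1) * V x)) / (U * U)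
    = - lam - (p - 1) * (W x * V x) * (u x powr (p - 1 - 1) / (U * U))"
    using U by (simp add: field_simps)
  also have "u x powr (p - 1 - 1) / (U * U) = 1 / u x powr p"
    unfolding UU using \<open>0 < u x\<close> by simp
  finally have "(- lam * U * U - W x * ((p - 1) * u x powr (p - 1 - 1) * V x)) / (U * U)
    = - (lam + (p - 1) * \<bar>W x / U\<bar> powr (p / (p - 1)))"
    unfolding abs by simp
  with D show ?thesis unfolding U_def by (simp only:)
qed

theorem theorem1p1:
  fixes p R :: real and u :: "real \<Rightarrow> real"
  assumes "1 < p" and "0 < R"
    and "first_eigenfunction p {-R<..<R} u" and "u 0 = 1"
  shows "\<forall>x\<in>{-R<..<R}. \<forall>y\<in>{-R<..<R}. x \<noteq> y \<longrightarrow>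
    (log_flux p u y - log_flux p u x) * ((y - x) / \<bar>y - x\<bar>) \<le> - 2 * log_Q p u (\<bar>x - y\<bar> / 2) \<and>
    ((log_flux p u y - log_flux p u x) * ((y - x) / \<bar>y - x\<bar>) = - 2 * log_Q p u (\<bar>x - y\<bar> / 2)
      \<longleftrightarrow> x = - y)"
proof -
  let ?I = "{-R<..<R}"
  have p: "0 < p - 1" "0 < 1 / (p - 1)" "0 < p / (p - 1)" using \<open>1 < p\<close> by auto
  have "- R < R" using \<open>0 < R\<close> by simp
  from first_eigenfunction_ODE[OF \<open>1 < p\<close> this assms(3)] obtain lam V W
    where lam: "0 < lam"
      and u: "\<And>x. x \<in> ?I \<Longrightarrow> (u has_real_derivative V x) (at x)"
      and VW: "\<And>x. x \<in> ?I \<Longrightarrow> signed_powr (p - 1) (V x) = W x"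
      and W: "\<And>x. x \<in> ?I \<Longrightarrow> (W has_real_derivative - lam * u x powr (p - 1)) (at x)"
      and lim: "(u \<longlongrightarrow> 0) (at_right (- R))" "(u \<longlongrightarrow> 0) (at_left R)"
    by blast
  have pos: "0 < u x" if "x \<in> ?I" for x
    using assms(3) that by (simp add: first_eigenfunction_def)
  define F where "F s = lam + (p - 1) * \<bar>s\<bar> powr (p / (p - 1))" for s
  define X where "X x = W x / u x powr (p - 1)" for x
  have X_eq: "X x = signed_powr (p - 1) (V x / u x)" if "x \<in> ?I" for x
    using pos[OF that] VW[OF that] by (simp add: X_def signed_powr_divide)
  have X: "(X has_real_derivative - F (X x)) (at x)" if "x \<in> ?I" for x
    unfolding X_def[abs_def] F_def
    by (rule riccati_DERIV[OF \<open>1 < p\<close> pos u W VW]) (rule that)+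
  have F_even: "F (- s) = F s" for s by (simp add: F_def)
  have F_pos: "0 < F s" for s using lam p by (simp add: F_def add_pos_nonneg)
  have F_mono: "F s < F t" if "\<bar>s\<bar> < \<bar>t\<bar>" for s t
    using that p by (simp add: F_def powr_less_mono2)
  have F_cont: "continuous_on UNIV F"
    unfolding F_def[abs_def] using p by (intro continuous_intros continuous_on_powr') auto
  have unbdd: "\<exists>x\<in>?I. X x < B" "\<exists>x\<in>?I. B < X x" for B
  proof -
    \<comment> \<open>A bound \<open>\<bar>B\<bar>\<close> on the flux corresponds to this bound on
      the logarithmic derivative V / u.\<close>
    define C where "C = \<bar>B\<bar> powr (1 / (p - 1))"
    have "0 \<le> C" by (simp add: C_def)
    show "\<exists>x\<in>?I. X x < B"
    proof (rule ccontr)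
      assume neg: "\<not> (\<exists>x\<in>?I. X x < B)"
      have V: "- C * u x \<le> V x" if "x \<in> ?I" for x
      proof -
        have "- \<bar>B\<bar> \<le> X x" using neg that by force
        then have "- C \<le> V x / u x"
          unfolding X_eq[OF that] C_def by (rule signed_powr_bound_imp_ge[OF p(1)]) simp
        then show ?thesis using pos[OF that] by (simp add: pos_le_divide_eq)
      qed
      have "\<not> (u \<longlongrightarrow> 0) (at_left R)"
        by (rule log_deriv_bound_imp_not_tendsto_0[OF \<open>0 < R\<close> _ \<open>0 \<le> C\<close> u V])
          (use \<open>0 < R\<close> \<open>u 0 = 1\<close> in auto)
      with lim(2) show False by contradiction
    qed
    show "\<exists>x\<in>?I. B < X x"
    proof (rule ccontr)
      assume neg: "\<not> (\<exists>x\<in>?I. B < X x)"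
      \<comment> \<open>The left end is reduced to the right one by reflection:
        \<open>- V (- x)\<close> is the derivative of u(-x).\<close>
      have V: "- C * u (- x) \<le> - V (- x)" if "x \<in> ?I" for x
      proof -
        have mx: "- x \<in> ?I" using that by auto
        then have "- \<bar>B\<bar> \<le> - X (- x)" using neg by force
        then have "- \<bar>B\<bar> \<le> signed_powr (p - 1) (- (V (- x) / u (- x)))"
          by (simp only: X_eq[OF mx] signed_powr_uminus)
        then have "- C \<le> - (V (- x) / u (- x))"
          unfolding C_def by (rule signed_powr_bound_imp_ge[OF p(1)]) simp
        then show ?thesis using pos[OF mx] by (simp add: pos_divide_le_eq)
      qed
      have "((\<lambda>x. u (- x)) has_real_derivative - V (- x)) (at x)" if "x \<in> ?I" for x
      proof -
        have "- x \<in> ?I" using that by auto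
        from DERIV_chain2[OF u[OF this] DERIV_minus[OF DERIV_ident]] show ?thesis by simp
      qed
      note u' = this
      have "\<not> ((\<lambda>x. u (- x)) \<longlongrightarrow> 0) (at_left R)"
        by (rule log_deriv_bound_imp_not_tendsto_0[OF \<open>0 < R\<close> _ \<open>0 \<le> C\<close> u' V])
          (use \<open>0 < R\<close> \<open>u 0 = 1\<close> in auto)
      moreover have "((\<lambda>x. u (- x)) \<longlongrightarrow> 0) (at_left R)"
        using lim(1) unfolding at_left_minus[of R] by (simp add: filterlim_filtermap)
      ultimately show False by contradiction
    qed
  qed
  have X_odd: "X (- x) = - X x" if "x \<in> ?I" for x
    by (rule odd_solution_of_even_autonomous_ODE[OF \<open>0 < R\<close> F_cont F_pos F_even X unbdd that])
  define T where "T x = - X x" for x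
  have T: "(T has_real_derivative F (T x)) (at x)" if "x \<in> ?I" for x
    unfolding T_def[abs_def] F_even using DERIV_minus[OF X[OF that]] by simp
  have T_odd: "T (- x) = - T x" if "x \<in> ?I" for x
    using X_odd[OF that] by (simp add: T_def)
  have modulus: "2 * T ((y - x) / 2) \<le> T y - T x" "2 * T ((y - x) / 2) = T y - T x \<longleftrightarrow> x = - y"
    if "x \<in> ?I" "y \<in> ?I" "x < y" for x y
    by (rule odd_autonomous_modulus[OF T T_odd F_pos F_mono], assumption+, (rule that)+)+
  have flux: "log_flux p u x = - T x" if x: "x \<in> ?I" for x
  proof -
    have "((\<lambda>t. ln (u t)) has_real_derivative 1 / u x * V x) (at x)"
      by (rule DERIV_chain2[OF DERIV_ln_divide[OF pos[OF x]] u[OF x]])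
    then have "deriv (\<lambda>t. ln (u t)) x = V x / u x" by (auto dest: DERIV_imp_deriv)
    \<comment> \<open>At s = 0 both sides are 0, also for p < 2, since
      \<open>0 powr a = 0\<close>.\<close>
    moreover have "\<bar>s\<bar> powr (p - 2) * s = signed_powr (p - 1) s" for s
    proof (cases "s = 0")
      case False
      have "signed_powr (p - 1) s = sgn s * (\<bar>s\<bar> powr (p - 2) * \<bar>s\<bar> powr 1)"
        unfolding signed_powr_def powr_add[symmetric] by simp
      then show ?thesis using False by (simp add: sgn_real_def)
    qed (simp add: signed_powr_def)
    ultimately show ?thesis by (simp only: log_flux_def T_def X_eq[OF x] minus_minus)
  qed
  have Q: "log_Q p u d = T d" if d: "0 < d" "d < R" for d
  proof -
    have dI: "d \<in> ?I" "- d \<in> ?I" using d by auto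
    have "- d < d" using d by simp
    then have "T (- d) < T d"
    proof (rule DERIV_pos_imp_increasing)
      fix z assume "- d \<le> z" "z \<le> d"
      then have "z \<in> ?I" using d by auto
      from T[OF this] F_pos show "\<exists>y. (T has_real_derivative y) (at z) \<and> 0 < y" by blast
    qed
    then have "0 < T d" using T_odd[OF dI(1)] by simp
    then have "signed_powr (p - 1) (V d / u d) < 0" by (simp add: T_def X_eq[OF dI(1)])
    \<comment> \<open>The sign matters: \<open>log_Q\<close> takes a real power of - V / u, which
      agrees with the odd power because the base is positive.\<close>
    then have neg: "V d / u d < 0"
      using signed_powr_nonneg[of "V d / u d" "p - 1"] by linarith
    then have "T d = (- (V d / u d)) powr (p - 1)"
      by (simp only: T_def X_eq[OF dI(1)] signed_powr_def sgn_neg abs_of_neg mult_minus1 minus_minus)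
    moreover have "deriv u d = V d" using u[OF dI(1)] by (rule DERIV_imp_deriv)
    ultimately show ?thesis by (simp add: log_Q_def log_q_def)
  qed
  show ?thesis
  proof (intro ballI impI)
    fix x y assume xy: "x \<in> ?I" "y \<in> ?I" "x \<noteq> y"
    have d: "0 < \<bar>x - y\<bar> / 2" "\<bar>x - y\<bar> / 2 < R" using xy by auto
    note eqs = flux[OF xy(1)] flux[OF xy(2)] Q[OF d]
    show "(log_flux p u y - log_flux p u x) * ((y - x) / \<bar>y - x\<bar>) \<le> - 2 * log_Q p u (\<bar>x - y\<bar> / 2) \<and>
      ((log_flux p u y - log_flux p u x) * ((y - x) / \<bar>y - x\<bar>) = - 2 * log_Q p u (\<bar>x - y\<bar> / 2)
        \<longleftrightarrow> x = - y)"
    \<comment> \<open>Both sides and the condition \<open>x = - y\<close> are symmetric in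
      \<open>x\<close> and \<open>y\<close>, so the second case is the first with the points
      exchanged.\<close>
    proof (cases "x < y")
      case True
      then have "(y - x) / \<bar>y - x\<bar> = 1" "\<bar>x - y\<bar> = y - x" by auto
      then show ?thesis
        using modulus[OF xy(1,2) True] unfolding eqs by auto
    next
      case False
      then have less: "y < x" using xy by simp
      then have "(y - x) / \<bar>y - x\<bar> = - 1" "\<bar>x - y\<bar> = x - y" by (auto simp: field_simps)
      then show ?thesis
        using modulus[OF xy(2,1) less] unfolding eqs by auto
    qed
  qed
qed

end
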